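(* Suppose Assumption A (constant $d$), Assumption M (constant $\kappa^*$) and Assumption E (constants $C_\lambda,L_\lambda$) hold, let $r>0$, and assume $(\log G_\epsilon)/m^*_\epsilon\to0$ as $\epsilon\to0$. Then: (i) with $D^*:=\lceil5L_\lambda/\kappa^*\rceil$ and $K^*:=16\big((1+1/d)\vee r/d^2\big)L_\lambda^2\big(8C_\lambda(1+1/d)\vee D^*\Lambda_{(D^* )}\big)(1\vee r)$, for every $\theta^\circ\in\Theta^r_{\mathfrak a}$, $$\lim_{\epsilon\to0}\mathbb E_{\theta^\circ}P_{\vartheta^M|Y}\big(\|\vartheta^M-\theta^\circ\|^2\le K^*\Phi^*_\epsilon\big)=1;$$ (ii) for every family $(K_\epsilon)_{\epsilon\in(0,1)}$ of positive numbers that increases as $\epsilon$ decreases and satisfies $K_\epsilon\to\infty$ as $\epsilon\to0$, $$\lim_{\epsilon\to0}\inf_{\theta^\circ\in\Theta^r_{\mathfrak a}}\mathbb E_{\theta^\circ}P_{\vartheta^M|Y}\big(\|\vartheta^M-\theta^\circ\|^2\le K_\epsilon\Phi^*_\epsilon\big)=1.$$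
   Context: Let $\ell^2$ be the space of square-summable real sequences with norm $\|\cdot\|$. Fix a bounded real sequence $\lambda=(\lambda_j)_{j\ge1}$ with $\lambda_j\ne0$ for all $j$ and a noise level $\epsilon\in(0,1)$. For a parameter $\theta^\circ$ the data $Y=(Y_j)_{j\ge1}$ satisfy $Y_j=\lambda_j\theta^\circ_j+\sqrt\epsilon\,\xi_j$ with $\xi_j$ i.i.d. $N(0,1)$; $\mathbb E_{\theta^\circ}$ denotes expectation under this law. Fix prior means $\eta=(\eta_j)_{j\ge1}$ and prior variances $\tau_j\in(0,\infty)$ (possibly depending on $\epsilon$). For $m\in\mathbb N$ the sieve prior is the law of $\vartheta^m$ with independent coordinates, $\vartheta^m_j\sim N(\eta_j,\tau_j)$ for $j\le m$ and $\vartheta^m_j=\eta_j$ a.s. for $j>m$; put $\sigma_j:=(\lambda_j^2\epsilon^{-1}+\tau_j^{-1})^{-1}$, $\theta^Y_j:=\sigma_j(\tau_j^{-1}\eta_j+\lambda_j\epsilon^{-1}Y_j)$; the posterior $P_{\vartheta^m|Y}$ makes the coordinates independent with $\vartheta^m_j\sim N(\theta^Y_j,\sigma_j)$ for $j\le m$ and $\vartheta^m_j=\eta_j$ for $j>m$; $\hat\theta^m_j:=\theta^Y_j$ for $j\le m$, $\hat\theta^m_j:=\eta_j$ for $j>m$. Let $\Lambda_j:=\lambda_j^{-2}$, $\Lambda_{(m)}:=\max_{1\le j\le m}\Lambda_j$, $\bar\Lambda_m:=m^{-1}\sum_{j=1}^m\Lambda_j$. Let $G_\epsilon:=\max\{1\le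 m\le\lfloor\epsilon^{-1}\rfloor:\epsilon\Lambda_{(m)}\le\Lambda_1\}$. Assumption A: there is $d>0$ with $\tau_j\ge d\,(\epsilon^{1/2}\Lambda_j^{1/2}\vee\epsilon\Lambda_j)$ for all $1\le j\le G_\epsilon$, $\epsilon\in(0,1)$. Assumption E: there are constants $C_\lambda\ge1$, $L_\lambda\ge1$ such that for all $k,l\in\mathbb N$: (i) $\sup_{j>k}\lambda_j^2\le C_\lambda\min_{1\le j\le k}\lambda_j^2=C_\lambda\Lambda_{(k)}^{-1}$; (ii) $\Lambda_{(kl)}\le\Lambda_{(k)}\Lambda_{(l)}$; (iii) $\Lambda_{(k)}/\bar\Lambda_k\le L_\lambda$. Let $\mathfrak a=(\mathfrak a_j)_{j\ge1}$ be strictly positive, non-increasing, with $\mathfrak a_1=1$ and $\mathfrak a_j\to0$; for $r>0$, $\Theta^r_{\mathfrak a}:=\{\theta:\sum_{j\ge1}(\theta_j-\eta_j)^2/\mathfrak a_j\le r\}$. Let $m^*_\epsilon:=\min\{m\ge1:\mathfrak a_m\vee\epsilon m\bar\Lambda_m\le\mathfrak a_k\vee\epsilon k\bar\Lambda_k\ \forall k\ge1\}$ and $\Phi^*_\epsilon:=\mathfrak a_{m^*_\epsilon}\vee\epsilon m^*_\epsilon\bar\Lambda_{m^*_\epsilon}$. Fix $\epsilon_o\in(0,1)$. Assumption M: $\kappa^*:=\inf_{0<\epsilon<\epsilon_o}(\Phi^*_\epsilon)^{-1}[\mathfrak a_{m^*_\epsilon}\wedge\epsilon m^*_\epsilon\bar\Lambda_{m^*_\epsilon}]>0$.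 Hierarchical prior: a random dimension $M$ with values in $\{1,\dots,G_\epsilon\}$ and $P(M=m)\propto\exp(-3C_\lambda m/2)\prod_{j=1}^m(\tau_j/\sigma_j)^{1/2}$; conditionally on $M=m$ the parameter $\vartheta^M$ has the law of $\vartheta^m$, and $Y_j=\lambda_j\vartheta^M_j+\sqrt\epsilon\xi_j$. The posterior of $M$ is $P_{M|Y}(M=m)=\exp(\frac12\{\|\hat\theta^m-\eta\|_\sigma^2-3C_\lambda m\})/\sum_{k=1}^{G_\epsilon}\exp(\frac12\{\|\hat\theta^k-\eta\|_\sigma^2-3C_\lambda k\})$ with $\|x\|_\sigma^2:=\sum_j x_j^2/\sigma_j$, and the posterior of $\vartheta^M$ is the mixture $P_{\vartheta^M|Y}=\sum_{m=1}^{G_\epsilon}P_{M|Y}(M=m)\,P_{\vartheta^m|Y}$. *)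

theory Defs
  imports "HOL-Probability.Probability"
begin

(* Sequences are functions nat => real, indexed from 1 as in the paper; index 0 is
   ignored by every definition below. *)

definition Lam :: "(nat \<Rightarrow> real) \<Rightarrow> nat \<Rightarrow> real" where
  "Lam lam j = 1 / (lam j)\<^sup>2"

definition Lmax :: "(nat \<Rightarrow> real) \<Rightarrow> nat \<Rightarrow> real" where
  "Lmax lam m = Max (Lam lam ` {1..m})"

definition Lbar :: "(nat \<Rightarrow> real) \<Rightarrow> nat \<Rightarrow> real" where
  "Lbar lam m = (\<Sum>j=1..m. Lam lam j) / real m"

definition Geps :: "(nat \<Rightarrow> real) \<Rightarrow> real \<Rightarrow> nat" where
  "Geps lam e = Max {m \<in> {1..nat \<lfloor>1 / e\<rfloor>}. e * Lmax lam m \<le> Lam lam 1}"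

definition mstar :: "(nat \<Rightarrow> real) \<Rightarrow> (nat \<Rightarrow> real) \<Rightarrow> real \<Rightarrow> nat" where
  "mstar a lam e = (LEAST m. 1 \<le> m \<and>
     (\<forall>k\<ge>1. max (a m) (e * real m * Lbar lam m) \<le> max (a k) (e * real k * Lbar lam k)))"

definition Phistar :: "(nat \<Rightarrow> real) \<Rightarrow> (nat \<Rightarrow> real) \<Rightarrow> real \<Rightarrow> real" where
  "Phistar a lam e = max (a (mstar a lam e)) (e * real (mstar a lam e) * Lbar lam (mstar a lam e))"

definition kappastar :: "(nat \<Rightarrow> real) \<Rightarrow> (nat \<Rightarrow> real) \<Rightarrow> real \<Rightarrow> real" where
  "kappastar a lam eo = Inf ((\<lambda>e. min (a (mstar a lam e)) (e * real (mstar a lam e) * Lbar lam (mstar a lam e))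
                                  / Phistar a lam e) ` {0<..<eo})"

(* posterior variance sigma_j and posterior mean theta^Y_j *)
definition sig :: "(nat \<Rightarrow> real) \<Rightarrow> (real \<Rightarrow> nat \<Rightarrow> real) \<Rightarrow> real \<Rightarrow> nat \<Rightarrow> real" where
  "sig lam tau e j = 1 / ((lam j)\<^sup>2 / e + 1 / tau e j)"

definition thetaY :: "(nat \<Rightarrow> real) \<Rightarrow> (nat \<Rightarrow> real) \<Rightarrow> (real \<Rightarrow> nat \<Rightarrow> real) \<Rightarrow> real
                       \<Rightarrow> (nat \<Rightarrow> real) \<Rightarrow> nat \<Rightarrow> real" where
  "thetaY lam eta tau e Y j = sig lam tau e j * (eta j / tau e j + lam j * Y j / e)"

definition signorm :: "(nat \<Rightarrow> real) \<Rightarrow> (nat \<Rightarrow> real) \<Rightarrow> (real \<Rightarrow> nat \<Rightarrow> real) \<Rightarrow> real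
                       \<Rightarrow> (nat \<Rightarrow> real) \<Rightarrow> nat \<Rightarrow> real" where
  "signorm lam eta tau e Y m = (\<Sum>j=1..m. (thetaY lam eta tau e Y j - eta j)\<^sup>2 / sig lam tau e j)"

definition postM :: "(nat \<Rightarrow> real) \<Rightarrow> (nat \<Rightarrow> real) \<Rightarrow> (real \<Rightarrow> nat \<Rightarrow> real) \<Rightarrow> real \<Rightarrow> real
                     \<Rightarrow> (nat \<Rightarrow> real) \<Rightarrow> nat \<Rightarrow> real" where
  "postM lam eta tau C e Y m =
     exp ((signorm lam eta tau e Y m - 3 * C * real m) / 2) /
     (\<Sum>k=1..Geps lam e. exp ((signorm lam eta tau e Y k - 3 * C * real k) / 2))"

definition post_sieve :: "(nat \<Rightarrow> real) \<Rightarrow> (nat \<Rightarrow> real) \<Rightarrow> (real \<Rightarrow> nat \<Rightarrow> real) \<Rightarrow> real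
                          \<Rightarrow> (nat \<Rightarrow> real) \<Rightarrow> nat \<Rightarrow> (nat \<Rightarrow> real) measure" where
  "post_sieve lam eta tau e Y m =
     PiM UNIV (\<lambda>j. if 1 \<le> j \<and> j \<le> m
                   then density lborel (normal_density (thetaY lam eta tau e Y j) (sqrt (sig lam tau e j)))
                   else return borel (eta j))"

definition post_hier :: "(nat \<Rightarrow> real) \<Rightarrow> (nat \<Rightarrow> real) \<Rightarrow> (real \<Rightarrow> nat \<Rightarrow> real) \<Rightarrow> real \<Rightarrow> real
                         \<Rightarrow> (nat \<Rightarrow> real) \<Rightarrow> (nat \<Rightarrow> real) set \<Rightarrow> real" where
  "post_hier lam eta tau C e Y A =
     (\<Sum>m=1..Geps lam e. postM lam eta tau C e Y m * measure (post_sieve lam eta tau e Y m) A)"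

definition l2sq :: "(nat \<Rightarrow> real) \<Rightarrow> ennreal" where
  "l2sq x = (\<Sum>j. ennreal ((x (Suc j))\<^sup>2))"

definition l2ball :: "(nat \<Rightarrow> real) \<Rightarrow> real \<Rightarrow> (nat \<Rightarrow> real) set" where
  "l2ball \<theta> c = {x. l2sq (\<lambda>j. x j - \<theta> j) \<le> ennreal c}"

definition noise :: "(nat \<Rightarrow> real) measure" where
  "noise = PiM UNIV (\<lambda>_. density lborel std_normal_density)"

definition exp_post :: "(nat \<Rightarrow> real) \<Rightarrow> (nat \<Rightarrow> real) \<Rightarrow> (real \<Rightarrow> nat \<Rightarrow> real) \<Rightarrow> real \<Rightarrow> real
                        \<Rightarrow> (nat \<Rightarrow> real) \<Rightarrow> real \<Rightarrow> real" where
  "exp_post lam eta tau C e \<theta> c =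
     (\<integral>\<xi>. post_hier lam eta tau C e (\<lambda>j. lam j * \<theta> j + sqrt e * \<xi> j) (l2ball \<theta> c) \<partial>noise)"

definition Theta :: "(nat \<Rightarrow> real) \<Rightarrow> (nat \<Rightarrow> real) \<Rightarrow> real \<Rightarrow> (nat \<Rightarrow> real) set" where
  "Theta a eta r = {\<theta>. (\<Sum>j. ennreal ((\<theta> (Suc j) - eta (Suc j))\<^sup>2 / a (Suc j))) \<le> ennreal r}"

end

theory Submission
  imports Defs
begin

text \<open>
  Write \<open>s\<^sub>j = 1 / (1 + \<epsilon>\<Lambda>\<^sub>j/\<tau>\<^sub>j)\<close> and \<open>x = \<theta> - \<eta>\<close>. The weighted norm of the posterior mean is
  \<open>\<Sum>\<^sub>j s\<^sub>j (\<lambda>\<^sub>j x\<^sub>j/\<surd>\<epsilon> + \<xi>\<^sub>j)\<^sup>2\<close>, so posterior odds between two dimensions are exponentials of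
  noncentral chi-square sums, whose moments are explicit. Comparing with the oracle dimension \<open>m*\<close>,
  a dimension \<open>m \<ge> D m*\<close>, or one with \<open>m < m*\<close> whose bias \<open>\<Sum>\<^bsub>j>m\<^esub> x\<^sub>j\<^sup>2\<close> exceeds a multiple of the
  rate, has expected posterior probability at most \<open>exp (- c m*)\<close>. For every other dimension
  Chernoff's bound, applied to the posterior draw and then to the data, shows that the sieve posterior
  puts expected mass at most \<open>exp (- c m*)\<close> outside the ball. The union bound costs a factor
  \<open>G\<^sub>\<epsilon> = exp (o(m*))\<close>.

  Only the tail energy \<open>\<delta> = \<Sum>\<^bsub>j>m*\<^esub> x\<^sub>j\<^sup>2/a\<^sub>j\<close> restricts the constant \<open>D\<close>: for a fixed parameter
  it tends to 0, which is why the radius \<open>r\<close> does not enter \<open>D*\<close> in the first claim, while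
  uniformly over the ellipsoid it is at most \<open>r\<close>, which is harmless when \<open>K\<^sub>\<epsilon> \<longlongrightarrow> \<infinity>\<close>.
\<close>

section \<open>Gaussian exponential moments\<close>

lemma prob_space_std_normal: "prob_space (density lborel std_normal_density)"
  by (rule prob_space_normal_density) simp

lemma prob_space_noise: "prob_space noise"
  unfolding noise_def by (intro prob_space_PiM prob_space_std_normal)

lemma sets_noise [measurable_cong]: "sets noise = sets (Pi\<^sub>M UNIV (\<lambda>_. borel))"
  unfolding noise_def by (intro sets_PiM_cong) auto

lemma space_noise [simp]: "space noise = UNIV"
  unfolding noise_def by (simp add: space_PiM)

lemma measurable_coord_noise [measurable]: "(\<lambda>\<xi>. \<xi> i) \<in> borel_measurable noise"
proof -
  have "(\<lambda>\<xi>. \<xi> i) \<in> measurable (Pi\<^sub>M UNIV (\<lambda>_. borel :: real measure)) borel"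
    by (rule measurable_component_singleton) simp
  then show ?thesis
    by (simp cong: measurable_cong_sets add: measurable_cong_sets[OF sets_noise refl])
qed

lemma distr_noise_coord: "distr noise borel (\<lambda>\<xi>. \<xi> i) = density lborel std_normal_density"
proof -
  have "distr noise borel (\<lambda>\<xi>. \<xi> i) = distr noise (density lborel std_normal_density) (\<lambda>\<xi>. \<xi> i)"
    by (rule distr_cong) auto
  also have "\<dots> = density lborel std_normal_density"
    unfolding noise_def by (rule distr_PiM_component) (auto intro: prob_space_std_normal)
  finally show ?thesis .
qed

lemma indep_vars_noise: "prob_space.indep_vars noise (\<lambda>_. borel) (\<lambda>i \<xi>. \<xi> i) UNIV"
proof -
  interpret prob_space noise by (rule prob_space_noise)
  have "distr noise (Pi\<^sub>M UNIV (\<lambda>_. borel)) (\<lambda>x. \<lambda>i\<in>UNIV. x i) = distr noise noise (\<lambda>x. x)"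
    by (rule distr_cong) (auto simp: sets_noise)
  also have "\<dots> = Pi\<^sub>M UNIV (\<lambda>i. distr noise borel (\<lambda>\<xi>. \<xi> i))"
    by (simp add: distr_id distr_noise_coord noise_def[symmetric])
  finally show ?thesis
    by (subst indep_vars_iff_distr_eq_PiM) auto
qed

lemma nn_integral_prod_noise:
  fixes f :: "nat \<Rightarrow> real \<Rightarrow> ennreal"
  assumes "finite I" and [measurable]: "\<And>i. f i \<in> borel_measurable borel"
  shows "(\<integral>\<^sup>+\<xi>. (\<Prod>i\<in>I. f i (\<xi> i)) \<partial>noise)
    = (\<Prod>i\<in>I. \<integral>\<^sup>+x. f i x \<partial>density lborel std_normal_density)"
proof -
  interpret prob_space noise by (rule prob_space_noise)
  have "indep_vars (\<lambda>_. borel) (\<lambda>i \<xi>. f i (\<xi> i)) I"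
    by (rule indep_vars_compose2[OF indep_vars_subset[OF indep_vars_noise]]) auto
  then have "(\<integral>\<^sup>+\<xi>. (\<Prod>i\<in>I. f i (\<xi> i)) \<partial>noise) = (\<Prod>i\<in>I. \<integral>\<^sup>+\<xi>. f i (\<xi> i) \<partial>noise)"
    by (intro indep_vars_nn_integral assms) auto
  also have "\<dots> = (\<Prod>i\<in>I. \<integral>\<^sup>+x. f i x \<partial>distr noise borel (\<lambda>\<xi>. \<xi> i))"
    by (intro prod.cong refl nn_integral_distr[symmetric]) auto
  finally show ?thesis by (simp add: distr_noise_coord)
qed

text \<open>Completing the square turns the integrand into a constant times the normal density with
  mean \<open>2*c*\<mu>/q\<close> and variance \<open>1/q\<close>, where \<open>q = 1 - 2*c\<close>;
  \<open>c < 1/2\<close> is what makes this variance positive.\<close>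

lemma nn_integral_exp_sq_std_normal:
  fixes c \<mu> :: real
  assumes "c < 1/2"
  shows "(\<integral>\<^sup>+x. ennreal (exp (c * (\<mu> + x)\<^sup>2)) \<partial>density lborel std_normal_density)
    = ennreal (exp (c * \<mu>\<^sup>2 / (1 - 2*c)) / sqrt (1 - 2*c))"
proof -
  define q where "q = 1 - 2*c"
  have q: "q > 0" and c: "c = (1 - q)/2" using assms by (auto simp: q_def)
  define A where "A = exp (c * \<mu>\<^sup>2 / q) / sqrt q"
  define n where "n = normal_density (2*c*\<mu>/q) (1 / sqrt q)"
  have "std_normal_density x * exp (c * (\<mu> + x)\<^sup>2) = A * n x" for x
  proof -
    have e: "- x\<^sup>2/2 + c * (\<mu> + x)\<^sup>2 = c * \<mu>\<^sup>2 / q - (x - 2*c*\<mu>/q)\<^sup>2 * q / 2"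
      using q unfolding c by (simp add: field_simps power2_eq_square)
    have "sqrt (2*pi*(1 / sqrt q)\<^sup>2) = sqrt (2*pi) / sqrt q"
      using q by (simp add: real_sqrt_divide power_divide)
    moreover have "- (x - 2*c*\<mu>/q)\<^sup>2 / (2 * (1 / sqrt q)\<^sup>2) = - ((x - 2*c*\<mu>/q)\<^sup>2 * q / 2)"
      using q by (simp add: power_divide)
    ultimately have n: "n x = sqrt q / sqrt (2*pi) * exp (- ((x - 2*c*\<mu>/q)\<^sup>2 * q / 2))"
      unfolding n_def normal_density_def by simp
    have "A * n x = 1 / sqrt (2*pi) * exp (c * \<mu>\<^sup>2 / q - (x - 2*c*\<mu>/q)\<^sup>2 * q / 2)"
      using q unfolding n A_def exp_diff by (simp add: exp_minus field_simps)
    also have "\<dots> = std_normal_density x * exp (c * (\<mu> + x)\<^sup>2)"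
      unfolding e[symmetric] exp_add by (simp add: std_normal_density_def)
    finally show ?thesis ..
  qed
  then have "(\<integral>\<^sup>+x. ennreal (exp (c * (\<mu> + x)\<^sup>2)) \<partial>density lborel std_normal_density)
    = (\<integral>\<^sup>+x. ennreal A * ennreal (n x) \<partial>lborel)"
    using q by (subst nn_integral_density)
      (auto intro!: nn_integral_cong simp: ennreal_mult'[symmetric] n_def A_def)
  also have "\<dots> = ennreal A * (\<integral>\<^sup>+x. ennreal (n x) \<partial>lborel)"
    by (intro nn_integral_cmult) (simp add: n_def)
  also have "(\<integral>\<^sup>+x. ennreal (n x) \<partial>lborel) = 1"
    using prob_space.emeasure_space_1[OF prob_space_normal_density[of "1 / sqrt q" "2*c*\<mu>/q"]] q
    by (simp add: emeasure_density n_def)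
  finally show ?thesis by (simp add: A_def q_def)
qed

text \<open>After squaring, \<open>exp (2*u) \<ge> 1 + 2*u\<close> reduces the claim to
  \<open>0 \<le> u * (1 - 2*u)\<close>, which is where \<open>u \<le> 1/2\<close> enters.\<close>

lemma inverse_sqrt_one_minus_le_exp:
  fixes u :: real
  assumes "0 \<le> u" "u \<le> 1/2"
  shows "1 / sqrt (1 - u) \<le> exp u"
proof -
  have "0 \<le> u * (1 - 2*u)" using assms by simp
  then have "1 \<le> (1 - u) * (1 + 2*u)" by (simp add: algebra_simps)
  also have "\<dots> \<le> (1 - u) * exp (2*u)"
    using assms exp_ge_add_one_self[of "2*u"] by (intro mult_left_mono) auto
  also have "\<dots> = (1 - u) * (exp u)\<^sup>2" by (simp add: exp_double)
  finally have "sqrt 1 \<le> sqrt ((1 - u) * (exp u)\<^sup>2)" by (rule real_sqrt_le_mono)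
  also have "\<dots> = sqrt (1 - u) * exp u" by (simp add: real_sqrt_mult)
  finally show ?thesis using assms by (simp add: field_simps)
qed

text \<open>For \<open>c \<le> 1/4\<close> the denominator \<open>1 - 2*c\<close> is at least 1/2.
  The bound is a single exponential, so bounds for different coordinates add up in the
  exponent.\<close>

lemma nn_integral_exp_sq_std_normal_le:
  fixes c \<mu> :: real
  assumes "0 \<le> c" "c \<le> 1/4"
  shows "(\<integral>\<^sup>+x. ennreal (exp (c * (\<mu> + x)\<^sup>2)) \<partial>density lborel std_normal_density)
    \<le> ennreal (exp (2*c + 2*c*\<mu>\<^sup>2))"
proof -
  have "c * \<mu>\<^sup>2 / (1 - 2*c) \<le> c * \<mu>\<^sup>2 / (1/2)"
    using assms by (intro divide_left_mono) auto
  then have "exp (c * \<mu>\<^sup>2 / (1 - 2*c)) * (1 / sqrt (1 - 2*c)) \<le> exp (2*c*\<mu>\<^sup>2) * exp (2*c)"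
    using assms by (intro mult_mono inverse_sqrt_one_minus_le_exp) auto
  then show ?thesis
    using assms by (subst nn_integral_exp_sq_std_normal)
      (auto intro!: ennreal_leI simp: exp_add mult.commute)
qed

lemma nn_integral_exp_sq_affine_std_normal_le:
  fixes c \<mu> w :: real
  assumes "0 \<le> c" "c * w\<^sup>2 \<le> 1/4" "w \<noteq> 0"
  shows "(\<integral>\<^sup>+x. ennreal (exp (c * (\<mu> + w * x)\<^sup>2)) \<partial>density lborel std_normal_density)
    \<le> ennreal (exp (2*c*w\<^sup>2 + 2*c*\<mu>\<^sup>2))"
proof -
  have eq: "c * (\<mu> + w * x)\<^sup>2 = (c * w\<^sup>2) * (\<mu>/w + x)\<^sup>2" for x
    using assms by (simp add: field_simps power2_eq_square)
  have eq': "2 * (c * w\<^sup>2) + 2 * (c * w\<^sup>2) * (\<mu>/w)\<^sup>2 = 2*c*w\<^sup>2 + 2*c*\<mu>\<^sup>2"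
    using assms by (simp add: power_divide)
  show ?thesis
    unfolding eq eq'[symmetric] using assms by (intro nn_integral_exp_sq_std_normal_le) auto
qed

text \<open>With a negative coefficient there is no integrability restriction, and the normalising
  factor \<open>1 / sqrt (1 + s)\<close> is at most 1. This serves the dimensions below the
  oracle.\<close>

lemma nn_integral_exp_minus_sq_std_normal_le:
  fixes s \<mu> :: real
  assumes "0 \<le> s"
  shows "(\<integral>\<^sup>+x. ennreal (exp (- (s/2) * (\<mu> + x)\<^sup>2)) \<partial>density lborel std_normal_density)
    \<le> ennreal (exp (- (s/2) * \<mu>\<^sup>2 / (1 + s)))"
proof -
  have "exp (- (s/2) * \<mu>\<^sup>2 / (1 + s)) / sqrt (1 + s) \<le> exp (- (s/2) * \<mu>\<^sup>2 / (1 + s)) / 1"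
    using assms by (intro divide_left_mono) auto
  then show ?thesis
    using assms by (subst nn_integral_exp_sq_std_normal) (auto intro!: ennreal_leI)
qed

section \<open>The sieve posterior as an image of Gaussian noise\<close>

lemma distr_std_normal_affine:
  assumes "0 < s"
  shows "distr (density lborel std_normal_density) borel (\<lambda>x. m + s * x)
    = density lborel (normal_density m s)"
proof -
  interpret prob_space "density lborel std_normal_density" by (rule prob_space_std_normal)
  have "distributed (density lborel std_normal_density) lborel (\<lambda>x. x) std_normal_density"
    unfolding distributed_def by (auto intro!: distr_id2)
  from normal_density_affine[OF this, of s m] assms
  have "distributed (density lborel std_normal_density) lborel (\<lambda>x. m + s * x) (normal_density m s)"
    by simp
  then have "distr (density lborel std_normal_density) lborel (\<lambda>x. m + s * x)
    = density lborel (normal_density m s)"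
    by (simp add: distributed_def)
  then show ?thesis by (simp cong: distr_cong)
qed

lemma distr_noise_coordwise:
  assumes [measurable]: "\<And>i. f i \<in> borel_measurable borel"
  shows "distr noise (Pi\<^sub>M UNIV (\<lambda>_. borel)) (\<lambda>z i. f i (z i))
    = Pi\<^sub>M UNIV (\<lambda>i. distr (density lborel std_normal_density) borel (f i :: real \<Rightarrow> real))"
proof -
  interpret prob_space noise by (rule prob_space_noise)
  have "indep_vars (\<lambda>_. borel) (\<lambda>i \<xi>. f i (\<xi> i)) UNIV"
    by (rule indep_vars_compose2[OF indep_vars_noise]) auto
  then have "distr noise (Pi\<^sub>M UNIV (\<lambda>_. borel)) (\<lambda>z. \<lambda>i\<in>UNIV. f i (z i))
    = Pi\<^sub>M UNIV (\<lambda>i. distr noise borel (\<lambda>z. f i (z i)))"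
    by (subst (asm) indep_vars_iff_distr_eq_PiM) auto
  moreover have "distr noise borel (\<lambda>z. f i (z i)) = distr (density lborel std_normal_density) borel (f i)" for i
    by (simp add: distr_noise_coord[of i, symmetric] distr_distr comp_def)
  ultimately show ?thesis by (simp add: restrict_def)
qed

text \<open>Realising the posterior as the image of a second, independent noise sequence makes its
  dependence on the data measurable and turns its expectation into a double integral.\<close>

definition post_draw :: "(nat \<Rightarrow> real) \<Rightarrow> (nat \<Rightarrow> real) \<Rightarrow> (real \<Rightarrow> nat \<Rightarrow> real) \<Rightarrow> real
    \<Rightarrow> (nat \<Rightarrow> real) \<Rightarrow> nat \<Rightarrow> (nat \<Rightarrow> real) \<Rightarrow> nat \<Rightarrow> real" where
  "post_draw lam eta tau e Y m z j = (if 1 \<le> j \<and> j \<le> m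
     then thetaY lam eta tau e Y j + sqrt (sig lam tau e j) * z j else eta j)"

lemma distr_const_return:
  assumes "prob_space M" "c \<in> space N"
  shows "distr M N (\<lambda>_. c) = return N c"
proof (rule measure_eqI)
  fix A assume "A \<in> sets (distr M N (\<lambda>_. c))"
  then have "A \<in> sets N" by simp
  then show "emeasure (distr M N (\<lambda>_. c)) A = emeasure (return N c) A"
    using assms prob_space.emeasure_space_1[OF assms(1)]
    by (subst emeasure_distr) (auto simp: indicator_def)
qed auto

lemma post_sieve_eq_distr:
  assumes "\<And>j. 1 \<le> j \<Longrightarrow> j \<le> m \<Longrightarrow> 0 < sig lam tau e j"
  shows "post_sieve lam eta tau e Y m
    = distr noise (Pi\<^sub>M UNIV (\<lambda>_. borel)) (post_draw lam eta tau e Y m)"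
proof -
  define f where "f j x = (if 1 \<le> j \<and> j \<le> m
     then thetaY lam eta tau e Y j + sqrt (sig lam tau e j) * x else eta j)" for j x
  have "distr noise (Pi\<^sub>M UNIV (\<lambda>_. borel)) (\<lambda>z j. f j (z j))
    = Pi\<^sub>M UNIV (\<lambda>j. distr (density lborel std_normal_density) borel (f j))"
    by (rule distr_noise_coordwise) (simp add: f_def)
  also have "\<dots> = post_sieve lam eta tau e Y m"
    unfolding post_sieve_def f_def using assms
    by (intro arg_cong[of _ _ "Pi\<^sub>M UNIV"] ext)
       (auto simp: distr_std_normal_affine distr_const_return[OF prob_space_std_normal])
  finally show ?thesis by (simp add: f_def post_draw_def[abs_def])
qed

section \<open>Posterior weights for a fixed noise level\<close>

lemma prod_ennreal_exp:
  "finite I \<Longrightarrow> (\<Prod>i\<in>I. ennreal (exp (f i))) = ennreal (exp (\<Sum>i\<in>I. f i))"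
  by (simp add: prod_ennreal exp_sum)

text \<open>Tensorisation: independence turns the integral into a product, so one-dimensional
  exponential bounds combine by adding their exponents.\<close>

lemma nn_integral_exp_sum_noise_le:
  fixes f :: "nat \<Rightarrow> real \<Rightarrow> real"
  assumes "finite I" "\<And>i. f i \<in> borel_measurable borel"
    and "\<And>i. i \<in> I \<Longrightarrow> (\<integral>\<^sup>+x. ennreal (exp (f i x)) \<partial>density lborel std_normal_density)
      \<le> ennreal (exp (g i))"
  shows "(\<integral>\<^sup>+\<xi>. ennreal (exp (\<Sum>i\<in>I. f i (\<xi> i))) \<partial>noise) \<le> ennreal (exp (\<Sum>i\<in>I. g i))"
proof -
  note [measurable] = assms(2)
  have "(\<integral>\<^sup>+\<xi>. ennreal (exp (\<Sum>i\<in>I. f i (\<xi> i))) \<partial>noise)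
    = (\<integral>\<^sup>+\<xi>. (\<Prod>i\<in>I. ennreal (exp (f i (\<xi> i)))) \<partial>noise)"
    using assms(1) by (simp add: prod_ennreal_exp)
  also have "\<dots> = (\<Prod>i\<in>I. \<integral>\<^sup>+x. ennreal (exp (f i x)) \<partial>density lborel std_normal_density)"
    by (rule nn_integral_prod_noise) (use assms in auto)
  also have "\<dots> \<le> (\<Prod>i\<in>I. ennreal (exp (g i)))"
    using assms(1,3) by (induction I rule: finite_induct) (auto intro!: mult_mono)
  finally show ?thesis using assms(1) by (simp add: prod_ennreal_exp)
qed

text \<open>Dimension 1 is always admissible because \<open>e < 1\<close>. Hence the
  \<open>Max\<close> in \<open>Geps\<close> is over a nonempty set and the normalising sum of
  \<open>postM\<close> has at least one term.\<close>

lemma one_le_Geps: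
  assumes "0 < e" "e < 1"
  shows "1 \<le> Geps lam e"
proof -
  have "e * Lam lam 1 \<le> 1 * Lam lam 1"
    using assms by (intro mult_right_mono) (auto simp: Lam_def)
  then have "1 \<in> {m \<in> {1..nat \<lfloor>1 / e\<rfloor>}. e * Lmax lam m \<le> Lam lam 1}"
    using assms by (auto simp: Lmax_def le_nat_iff le_floor_iff)
  then show ?thesis unfolding Geps_def by (intro Max_ge) auto
qed

locale sieve_model =
  fixes lam eta :: "nat \<Rightarrow> real" and tau :: "real \<Rightarrow> nat \<Rightarrow> real" and e :: real
    and \<theta> :: "nat \<Rightarrow> real" and C :: real
  assumes e: "0 < e" "e < 1"
    and lam_nz: "\<And>j. 1 \<le> j \<Longrightarrow> lam j \<noteq> 0"
    and tau_pos: "\<And>j. 1 \<le> j \<Longrightarrow> 0 < tau e j"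
begin

text \<open>The weight of the data against the prior: the posterior mean moves from
  \<open>eta j\<close> towards the inverted observation \<open>Y j / lam j\<close> by this
  fraction.\<close>

definition shrink :: "nat \<Rightarrow> real" where "shrink j = 1 / (1 + e * Lam lam j / tau e j)"

definition offset :: "nat \<Rightarrow> real" where "offset j = \<theta> j - eta j"

text \<open>The signed signal-to-noise ratio, whose square is the noncentrality parameter of the
  chi-square variables below.\<close>

definition snr :: "nat \<Rightarrow> real" where "snr j = lam j * offset j / sqrt e"

definition obs :: "(nat \<Rightarrow> real) \<Rightarrow> nat \<Rightarrow> real" where "obs \<xi> j = lam j * \<theta> j + sqrt e * \<xi> j"

text \<open>The squared truncation bias of dimension \<open>m\<close>; the shift makes the sum start
  at coordinate \<open>m + 1\<close>.\<close>

definition tail :: "nat \<Rightarrow> real" where "tail m = (\<Sum>j. (offset (Suc (j + m)))\<^sup>2)"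

definition miss :: "nat \<Rightarrow> real \<Rightarrow> (nat \<Rightarrow> real) \<Rightarrow> real" where
  "miss m c \<xi> = measure noise {z. post_draw lam eta tau e (obs \<xi>) m z \<notin> l2ball \<theta> c}"

lemma Lam_pos: "1 \<le> j \<Longrightarrow> 0 < Lam lam j"
  using lam_nz by (simp add: Lam_def)

lemma shrink_pos: "1 \<le> j \<Longrightarrow> 0 < shrink j"
  and shrink_le_1: "1 \<le> j \<Longrightarrow> shrink j \<le> 1"
  using Lam_pos[of j] tau_pos[of j] e by (auto simp: shrink_def add_pos_pos)

lemma sig_eq: "1 \<le> j \<Longrightarrow> sig lam tau e j = shrink j * (e * Lam lam j)"
  using tau_pos[of j] lam_nz[of j] e
  by (simp add: sig_def shrink_def Lam_def divide_simps add_pos_pos add_nonneg_eq_0_iff)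

lemma sig_pos: "1 \<le> j \<Longrightarrow> 0 < sig lam tau e j"
  using shrink_pos[of j] Lam_pos[of j] e by (simp add: sig_eq)

lemma thetaY_minus_eta:
  assumes "1 \<le> j"
  shows "thetaY lam eta tau e (obs \<xi>) j - eta j = shrink j * (offset j + sqrt e / lam j * \<xi> j)"
proof -
  note p = tau_pos[OF assms] lam_nz[OF assms] sig_pos[OF assms]
  \<comment> \<open>Writing \<open>eta j\<close> as \<open>sig * (eta j * (1 / sig))\<close> brings
    it inside the bracket, where the prior precision term cancels and only the data term is
    left.\<close>
  have s: "1 / sig lam tau e j = (lam j)\<^sup>2 / e + 1 / tau e j" by (simp add: sig_def)
  have "thetaY lam eta tau e (obs \<xi>) j - eta j
    = sig lam tau e j * (eta j / tau e j + lam j * obs \<xi> j / e - eta j * (1 / sig lam tau e j))"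
    using p by (simp add: thetaY_def algebra_simps)
  also have "eta j / tau e j + lam j * obs \<xi> j / e - eta j * (1 / sig lam tau e j)
    = (lam j)\<^sup>2 / e * (offset j + sqrt e / lam j * \<xi> j)"
    unfolding s obs_def offset_def using p e by (simp add: field_simps power2_eq_square)
  also have "sig lam tau e j * \<dots> = shrink j * (offset j + sqrt e / lam j * \<xi> j)"
    using p(2) e sig_eq[OF assms] by (simp add: Lam_def)
  finally show ?thesis .
qed

text \<open>Dividing by \<open>sig\<close> cancels one of the two shrinkage factors and the noise
  variance, which leaves a weighted noncentral chi-square sum.\<close>

lemma signorm_eq:
  "signorm lam eta tau e (obs \<xi>) m = (\<Sum>j=1..m. shrink j * (snr j + \<xi> j)\<^sup>2)"
  unfolding signorm_def
proof (intro sum.cong refl)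
  fix j assume "j \<in> {1..m}"
  then have j: "1 \<le> j" by simp
  have "offset j + sqrt e / lam j * \<xi> j = sqrt e / lam j * (snr j + \<xi> j)"
    using lam_nz[OF j] e by (simp add: snr_def field_simps)
  then have "(thetaY lam eta tau e (obs \<xi>) j - eta j)\<^sup>2
    = (shrink j)\<^sup>2 * (e * Lam lam j) * (snr j + \<xi> j)\<^sup>2"
    using e by (simp add: thetaY_minus_eta[OF j] Lam_def power_mult_distrib power_divide)
  also have "\<dots> = sig lam tau e j * (shrink j * (snr j + \<xi> j)\<^sup>2)"
    by (simp add: sig_eq[OF j] power2_eq_square)
  finally show "(thetaY lam eta tau e (obs \<xi>) j - eta j)\<^sup>2 / sig lam tau e j
    = shrink j * (snr j + \<xi> j)\<^sup>2"
    using sig_pos[OF j] by simp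
qed

section \<open>Posterior weights of the dimensions\<close>

lemma measurable_postM [measurable]:
  "(\<lambda>\<xi>. postM lam eta tau C e (obs \<xi>) m) \<in> borel_measurable noise"
  unfolding postM_def signorm_eq by measurable

lemma postM_denom_pos:
  "0 < (\<Sum>k=1..Geps lam e. exp ((signorm lam eta tau e Y k - 3 * C * real k) / 2))"
  using one_le_Geps[OF e] by (intro sum_pos) auto

lemma postM_nonneg: "0 \<le> postM lam eta tau C e Y m"
  unfolding postM_def using postM_denom_pos[of Y] by simp

lemma sum_postM: "(\<Sum>m=1..Geps lam e. postM lam eta tau C e Y m) = 1"
  unfolding postM_def sum_divide_distrib[symmetric] using postM_denom_pos[of Y] by simp

lemma postM_le_1: "m \<in> {1..Geps lam e} \<Longrightarrow> postM lam eta tau C e Y m \<le> 1"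
  using member_le_sum[of m "{1..Geps lam e}" "postM lam eta tau C e Y"] sum_postM[of Y]
  by (auto simp: postM_nonneg)

text \<open>Keeping only the \<open>k\<close>-th term of the normalising sum bounds the weight by
  the posterior odds of \<open>m\<close> against \<open>k\<close>.\<close>

lemma postM_le_ratio:
  assumes "k \<in> {1..Geps lam e}"
  shows "postM lam eta tau C e Y m \<le> exp (((signorm lam eta tau e Y m - 3 * C * real m)
    - (signorm lam eta tau e Y k - 3 * C * real k)) / 2)"
proof -
  let ?w = "\<lambda>k. exp ((signorm lam eta tau e Y k - 3 * C * real k) / 2)"
  have "?w k \<le> sum ?w {1..Geps lam e}"
    using assms by (intro member_le_sum) auto
  then have "postM lam eta tau C e Y m \<le> ?w m / ?w k"
    unfolding postM_def using postM_denom_pos[of Y] by (intro divide_left_mono mult_pos_pos) auto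
  then show ?thesis by (simp add: exp_diff[symmetric] diff_divide_distrib)
qed

text \<open>Since the posterior weight is also at most 1, the likelihood ratio may be replaced by its
  square root; this keeps the exponential moment of the noncentral chi-square finite.\<close>

lemma nn_integral_postM_above:
  assumes "k \<in> {1..Geps lam e}" "k \<le> m" "m \<in> {1..Geps lam e}"
  shows "(\<integral>\<^sup>+\<xi>. ennreal (postM lam eta tau C e (obs \<xi>) m) \<partial>noise)
    \<le> ennreal (exp (\<Sum>j\<in>{k<..m}. 1/2 + (snr j)\<^sup>2 / 2 - 3 * C / 4))"
proof -
  have split: "{1..m} = {1..k} \<union> {k<..m}" using assms by auto
  have "postM lam eta tau C e (obs \<xi>) m
    \<le> exp (\<Sum>j\<in>{k<..m}. shrink j / 4 * (snr j + \<xi> j)\<^sup>2 - 3 * C / 4)" for \<xi>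
  proof -
    let ?z = "(signorm lam eta tau e (obs \<xi>) m - 3 * C * real m)
      - (signorm lam eta tau e (obs \<xi>) k - 3 * C * real k)"
    have "postM lam eta tau C e (obs \<xi>) m \<le> exp (?z / 4)"
    proof (cases "0 \<le> ?z")
      case True
      then show ?thesis using order_trans[OF postM_le_1[OF assms(3), of "obs \<xi>"]] by simp
    next
      case False
      then show ?thesis
        by (intro order_trans[OF postM_le_ratio[OF assms(1)]]) simp
    qed
    also have "?z = (\<Sum>j\<in>{k<..m}. shrink j * (snr j + \<xi> j)\<^sup>2) - 3 * C * real (m - k)"
      using assms unfolding signorm_eq split by (subst sum.union_disjoint) (auto simp: of_nat_diff algebra_simps)
    also have "\<dots> / 4 = (\<Sum>j\<in>{k<..m}. shrink j / 4 * (snr j + \<xi> j)\<^sup>2 - 3 * C / 4)"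
      by (simp add: sum_subtractf sum_divide_distrib diff_divide_distrib)
    finally show ?thesis .
  qed
  then have "(\<integral>\<^sup>+\<xi>. ennreal (postM lam eta tau C e (obs \<xi>) m) \<partial>noise)
    \<le> (\<integral>\<^sup>+\<xi>. ennreal (exp (\<Sum>j\<in>{k<..m}. shrink j / 4 * (snr j + \<xi> j)\<^sup>2 - 3 * C / 4)) \<partial>noise)"
    by (intro nn_integral_mono ennreal_leI) auto
  also have "\<dots> \<le> ennreal (exp (\<Sum>j\<in>{k<..m}. 1/2 + (snr j)\<^sup>2 / 2 - 3 * C / 4))"
  proof (rule nn_integral_exp_sum_noise_le)
    fix j assume "j \<in> {k<..m}"
    then have j: "1 \<le> j" by auto
    \<comment> \<open>Since \<open>shrink j \<le> 1\<close>, the coefficient may be raised to 1/4,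
      the largest one covered by \<open>nn_integral_exp_sq_std_normal_le\<close>.\<close>
    have "(\<integral>\<^sup>+x. ennreal (exp (shrink j / 4 * (snr j + x)\<^sup>2 - 3 * C / 4)) \<partial>density lborel std_normal_density)
      \<le> (\<integral>\<^sup>+x. ennreal (exp (- 3 * C / 4)) * ennreal (exp (1/4 * (snr j + x)\<^sup>2)) \<partial>density lborel std_normal_density)"
      using shrink_le_1[OF j] less_imp_le[OF shrink_pos[OF j]]
      by (intro nn_integral_mono) (auto simp: ennreal_mult'[symmetric] exp_add[symmetric]
         intro!: ennreal_leI mult_right_mono mult_left_le_one_le)
    also have "\<dots> = ennreal (exp (- 3 * C / 4)) * (\<integral>\<^sup>+x. ennreal (exp (1/4 * (snr j + x)\<^sup>2)) \<partial>density lborel std_normal_density)"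
      by (rule nn_integral_cmult) simp
    also have "\<dots> \<le> ennreal (exp (- 3 * C / 4)) * ennreal (exp (2*(1/4) + 2*(1/4)*(snr j)\<^sup>2))"
      by (intro mult_left_mono nn_integral_exp_sq_std_normal_le) auto
    also have "\<dots> = ennreal (exp (1/2 + (snr j)\<^sup>2 / 2 - 3 * C / 4))"
      by (simp add: ennreal_mult'[symmetric] exp_add[symmetric] algebra_simps)
    finally show "(\<integral>\<^sup>+x. ennreal (exp (shrink j / 4 * (snr j + x)\<^sup>2 - 3 * C / 4)) \<partial>density lborel std_normal_density)
      \<le> ennreal (exp (1/2 + (snr j)\<^sup>2 / 2 - 3 * C / 4))" .
  qed auto
  finally show ?thesis .
qed

text \<open>Here the chi-square sum over the coordinates that \<open>m\<close> omits enters the log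
  odds with a negative sign. The full ratio is therefore integrable, and strong omitted signal
  outweighs the gain \<open>3 * C / 2\<close> per coordinate from the dimension penalty.\<close>

lemma nn_integral_postM_below:
  assumes "k \<in> {1..Geps lam e}" "m \<le> k"
  shows "(\<integral>\<^sup>+\<xi>. ennreal (postM lam eta tau C e (obs \<xi>) m) \<partial>noise)
    \<le> ennreal (exp (\<Sum>j\<in>{m<..k}. 3 * C / 2 - (shrink j / 2) * (snr j)\<^sup>2 / (1 + shrink j)))"
proof -
  have split: "{1..k} = {1..m} \<union> {m<..k}" using assms by auto
  have "postM lam eta tau C e (obs \<xi>) m
    \<le> exp (\<Sum>j\<in>{m<..k}. 3 * C / 2 + - (shrink j / 2) * (snr j + \<xi> j)\<^sup>2)" for \<xi>
  proof -
    let ?z = "(signorm lam eta tau e (obs \<xi>) m - 3 * C * real m)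
      - (signorm lam eta tau e (obs \<xi>) k - 3 * C * real k)"
    have "postM lam eta tau C e (obs \<xi>) m \<le> exp (?z / 2)"
      by (rule postM_le_ratio[OF assms(1)])
    also have "?z = 3 * C * real (k - m) - (\<Sum>j\<in>{m<..k}. shrink j * (snr j + \<xi> j)\<^sup>2)"
      using assms unfolding signorm_eq split by (subst sum.union_disjoint) (auto simp: of_nat_diff algebra_simps)
    also have "\<dots> / 2 = (\<Sum>j\<in>{m<..k}. 3 * C / 2 + - (shrink j / 2) * (snr j + \<xi> j)\<^sup>2)"
      by (simp add: sum_subtractf sum_divide_distrib diff_divide_distrib)
    finally show ?thesis .
  qed
  then have "(\<integral>\<^sup>+\<xi>. ennreal (postM lam eta tau C e (obs \<xi>) m) \<partial>noise)
    \<le> (\<integral>\<^sup>+\<xi>. ennreal (exp (\<Sum>j\<in>{m<..k}. 3 * C / 2 + - (shrink j / 2) * (snr j + \<xi> j)\<^sup>2)) \<partial>noise)"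
    by (intro nn_integral_mono ennreal_leI) auto
  also have "\<dots> \<le> ennreal (exp (\<Sum>j\<in>{m<..k}. 3 * C / 2 - (shrink j / 2) * (snr j)\<^sup>2 / (1 + shrink j)))"
  proof (rule nn_integral_exp_sum_noise_le)
    fix j assume "j \<in> {m<..k}"
    then have j: "1 \<le> j" by auto
    have "(\<integral>\<^sup>+x. ennreal (exp (3 * C / 2 + - (shrink j / 2) * (snr j + x)\<^sup>2)) \<partial>density lborel std_normal_density)
      = (\<integral>\<^sup>+x. ennreal (exp (3 * C / 2)) * ennreal (exp (- (shrink j / 2) * (snr j + x)\<^sup>2)) \<partial>density lborel std_normal_density)"
      by (simp add: ennreal_mult'[symmetric] exp_add[symmetric])
    also have "\<dots> = ennreal (exp (3 * C / 2)) * (\<integral>\<^sup>+x. ennreal (exp (- (shrink j / 2) * (snr j + x)\<^sup>2)) \<partial>density lborel std_normal_density)"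
      by (rule nn_integral_cmult) simp
    also have "\<dots> \<le> ennreal (exp (3 * C / 2)) * ennreal (exp (- (shrink j / 2) * (snr j)\<^sup>2 / (1 + shrink j)))"
      using shrink_pos[OF j] by (intro mult_left_mono nn_integral_exp_minus_sq_std_normal_le) auto
    also have "\<dots> = ennreal (exp (3 * C / 2 - (shrink j / 2) * (snr j)\<^sup>2 / (1 + shrink j)))"
      by (simp add: ennreal_mult'[symmetric] exp_add[symmetric])
    finally show "(\<integral>\<^sup>+x. ennreal (exp (3 * C / 2 + - (shrink j / 2) * (snr j + x)\<^sup>2)) \<partial>density lborel std_normal_density)
      \<le> ennreal (exp (3 * C / 2 - (shrink j / 2) * (snr j)\<^sup>2 / (1 + shrink j)))" .
  qed auto
  finally show ?thesis .
qed

end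

section \<open>Posterior mass outside a ball\<close>

lemma measurable_l2sq_diff [measurable]:
  "(\<lambda>x. l2sq (\<lambda>j. x j - \<theta> j)) \<in> borel_measurable (Pi\<^sub>M UNIV (\<lambda>_. borel))"
  unfolding l2sq_def by measurable

lemma l2ball_sets [measurable]: "l2ball \<theta> c \<in> sets (Pi\<^sub>M UNIV (\<lambda>_. borel))"
proof -
  have "{x \<in> space (Pi\<^sub>M UNIV (\<lambda>_. borel)). l2sq (\<lambda>j. x j - \<theta> j) \<le> ennreal c} \<in> sets (Pi\<^sub>M UNIV (\<lambda>_. borel))"
    by measurable
  then show ?thesis by (simp add: l2ball_def space_PiM)
qed

context sieve_model
begin

lemma measurable_post_draw [measurable]:
  "(\<lambda>(\<xi>, z). post_draw lam eta tau e (obs \<xi>) m z) \<in> measurable (noise \<Otimes>\<^sub>M noise) (Pi\<^sub>M UNIV (\<lambda>_. borel))"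
proof (rule measurable_PiM_single')
  fix j
  have "(\<lambda>(\<xi>, z). post_draw lam eta tau e (obs \<xi>) m z j) \<in> borel_measurable (noise \<Otimes>\<^sub>M noise)"
    unfolding post_draw_def thetaY_def obs_def by measurable
  then show "(\<lambda>p. (case p of (\<xi>, z) \<Rightarrow> post_draw lam eta tau e (obs \<xi>) m z) j) \<in> borel_measurable (noise \<Otimes>\<^sub>M noise)"
    by (simp add: case_prod_beta')
qed auto

lemma measurable_post_draw_fixed [measurable]:
  "post_draw lam eta tau e (obs \<xi>) m \<in> measurable noise (Pi\<^sub>M UNIV (\<lambda>_. borel))"
proof -
  have "(\<lambda>z. case (\<xi>, z) of (\<xi>, z) \<Rightarrow> post_draw lam eta tau e (obs \<xi>) m z) \<in> measurable noise (Pi\<^sub>M UNIV (\<lambda>_. borel))"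
    by (rule measurable_compose[OF measurable_Pair1' measurable_post_draw]) simp
  then show ?thesis by simp
qed

lemma miss_set: "{z. post_draw lam eta tau e (obs \<xi>) m z \<notin> l2ball \<theta> c} \<in> sets noise"
  using measurable_sets[OF measurable_post_draw_fixed sets.compl_sets[OF l2ball_sets[of \<theta> c]]]
  by (simp add: space_PiM vimage_def)

lemma measurable_miss [measurable]: "miss m c \<in> borel_measurable noise"
proof -
  interpret N: prob_space noise by (rule prob_space_noise)
  let ?D = "\<lambda>(\<xi>, z). post_draw lam eta tau e (obs \<xi>) m z"
  \<comment> \<open>\<open>miss\<close> measures the sections of a jointly measurable subset of the
    product of data noise and posterior noise.\<close>
  have "?D -` (UNIV - l2ball \<theta> c) \<inter> space (noise \<Otimes>\<^sub>M noise) \<in> sets (noise \<Otimes>\<^sub>M noise)"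
    using sets.compl_sets[OF l2ball_sets[of \<theta> c]]
    by (intro measurable_sets[OF measurable_post_draw]) (simp add: space_PiM)
  then have "(\<lambda>\<xi>. emeasure noise (Pair \<xi> -` (?D -` (UNIV - l2ball \<theta> c) \<inter> space (noise \<Otimes>\<^sub>M noise))))
    \<in> borel_measurable noise"
    by (rule N.measurable_emeasure_Pair)
  then have "(\<lambda>\<xi>. emeasure noise {z. post_draw lam eta tau e (obs \<xi>) m z \<notin> l2ball \<theta> c})
    \<in> borel_measurable noise"
    by (simp add: vimage_def space_pair_measure)
  then have "(\<lambda>\<xi>. measure noise {z. post_draw lam eta tau e (obs \<xi>) m z \<notin> l2ball \<theta> c})
    \<in> borel_measurable noise"
    unfolding measure_def by measurable
  then show ?thesis by (simp add: miss_def[abs_def])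
qed

lemma miss_bounds: "0 \<le> miss m c \<xi>" "miss m c \<xi> \<le> 1"
  using prob_space.prob_le_1[OF prob_space_noise] by (auto simp: miss_def)

lemma measure_post_sieve_l2ball:
  "measure (post_sieve lam eta tau e (obs \<xi>) m) (l2ball \<theta> c) = 1 - miss m c \<xi>"
proof -
  interpret N: prob_space noise by (rule prob_space_noise)
  have "measure (post_sieve lam eta tau e (obs \<xi>) m) (l2ball \<theta> c)
    = measure noise {z. post_draw lam eta tau e (obs \<xi>) m z \<in> l2ball \<theta> c}"
    by (subst post_sieve_eq_distr) (auto simp: sig_pos measure_distr vimage_def)
  also have "{z. post_draw lam eta tau e (obs \<xi>) m z \<in> l2ball \<theta> c}
    = space noise - {z. post_draw lam eta tau e (obs \<xi>) m z \<notin> l2ball \<theta> c}" by auto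
  also have "measure noise \<dots> = 1 - miss m c \<xi>"
    unfolding miss_def by (rule N.prob_compl[OF miss_set])
  finally show ?thesis .
qed

text \<open>The mixture misses the ball with mass equal to the sum of \<open>postM * miss\<close>.
  Both factors lie between 0 and 1, so for each dimension it suffices that one of them has small
  expectation; summing over the \<open>Geps\<close> dimensions is the union bound.\<close>

lemma exp_post_bounds:
  assumes "0 \<le> q"
    and "\<And>m. m \<in> {1..Geps lam e} \<Longrightarrow>
      (\<integral>\<^sup>+\<xi>. ennreal (postM lam eta tau C e (obs \<xi>) m) \<partial>noise) \<le> ennreal q \<or>
      (\<integral>\<^sup>+\<xi>. ennreal (miss m c \<xi>) \<partial>noise) \<le> ennreal q"
  shows "1 - real (Geps lam e) * q \<le> exp_post lam eta tau C e \<theta> c"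
    and "exp_post lam eta tau C e \<theta> c \<le> 1"
proof -
  interpret N: prob_space noise by (rule prob_space_noise)
  let ?G = "{1..Geps lam e}"
  let ?p = "\<lambda>\<xi> m. postM lam eta tau C e (obs \<xi>) m"
  have post: "post_hier lam eta tau C e (obs \<xi>) (l2ball \<theta> c) = 1 - (\<Sum>m\<in>?G. ?p \<xi> m * miss m c \<xi>)" for \<xi>
    unfolding post_hier_def measure_post_sieve_l2ball using sum_postM[of "obs \<xi>"]
    by (simp add: right_diff_distrib sum_subtractf)
  have int: "integrable noise (\<lambda>\<xi>. ?p \<xi> m * miss m c \<xi>)" if "m \<in> ?G" for m
    by (rule N.integrable_const_bound[of _ 1])
       (auto simp: abs_mult postM_nonneg miss_bounds intro!: mult_le_one postM_le_1[OF that])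
  have le: "(\<integral>\<xi>. ?p \<xi> m * miss m c \<xi> \<partial>noise) \<le> q" if m: "m \<in> ?G" for m
  proof -
    have p: "?p \<xi> m * miss m c \<xi> \<le> ?p \<xi> m" "?p \<xi> m * miss m c \<xi> \<le> miss m c \<xi>" for \<xi>
      using postM_nonneg[of "obs \<xi>" m] postM_le_1[OF m, of "obs \<xi>"] miss_bounds[of m c \<xi>]
      by (auto intro: mult_left_le mult_left_le_one_le)
    have "(\<integral>\<^sup>+\<xi>. ennreal (?p \<xi> m * miss m c \<xi>) \<partial>noise) \<le> ennreal q"
      using assms(2)[OF m]
      by (auto elim!: order_trans[rotated] intro!: nn_integral_mono ennreal_leI p)
    also have "(\<integral>\<^sup>+\<xi>. ennreal (?p \<xi> m * miss m c \<xi>) \<partial>noise) = ennreal (\<integral>\<xi>. ?p \<xi> m * miss m c \<xi> \<partial>noise)"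
      by (rule nn_integral_eq_integral[OF int[OF m]]) (simp add: postM_nonneg miss_bounds)
    finally show ?thesis using assms(1) by (simp add: ennreal_le_iff)
  qed
  have "exp_post lam eta tau C e \<theta> c = (\<integral>\<xi>. 1 - (\<Sum>m\<in>?G. ?p \<xi> m * miss m c \<xi>) \<partial>noise)"
    unfolding exp_post_def post[symmetric] obs_def ..
  also have "\<dots> = 1 - (\<Sum>m\<in>?G. \<integral>\<xi>. ?p \<xi> m * miss m c \<xi> \<partial>noise)"
    using int by (subst Bochner_Integration.integral_diff) (use N.prob_space in auto)
  finally have eq: "exp_post lam eta tau C e \<theta> c = 1 - (\<Sum>m\<in>?G. \<integral>\<xi>. ?p \<xi> m * miss m c \<xi> \<partial>noise)" .
  have "(\<Sum>m\<in>?G. \<integral>\<xi>. ?p \<xi> m * miss m c \<xi> \<partial>noise) \<le> real (card ?G) * q"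
    by (rule sum_bounded_above) (rule le)
  then show "1 - real (Geps lam e) * q \<le> exp_post lam eta tau C e \<theta> c"
    unfolding eq by simp
  show "exp_post lam eta tau C e \<theta> c \<le> 1"
    unfolding eq by (auto intro!: sum_nonneg Bochner_Integration.integral_nonneg mult_nonneg_nonneg postM_nonneg miss_bounds)
qed

text \<open>Coordinates beyond \<open>m\<close> of a draw equal the prior mean, so they contribute
  exactly the deterministic amount \<open>tail m\<close>.\<close>

lemma l2sq_post_draw_le:
  assumes "summable (\<lambda>j. (offset (Suc j))\<^sup>2)"
    and "(\<Sum>j=1..m. (post_draw lam eta tau e Y m z j - \<theta> j)\<^sup>2) + tail m \<le> c"
  shows "post_draw lam eta tau e Y m z \<in> l2ball \<theta> c"
proof -
  let ?y = "\<lambda>j. (post_draw lam eta tau e Y m z (Suc j) - \<theta> (Suc j))\<^sup>2"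
  have y: "?y (j + m) = (offset (Suc (j + m)))\<^sup>2" for j
    by (simp add: post_draw_def offset_def power2_commute)
  have "summable (\<lambda>j. ?y (j + m))"
    unfolding y using assms(1) by (subst summable_iff_shift)
  then have sum: "summable ?y" by (subst (asm) summable_iff_shift)
  have "(\<Sum>j. ?y j) = (\<Sum>j. ?y (j + m)) + (\<Sum>j<m. ?y j)"
    by (rule suminf_split_initial_segment[OF sum])
  also have "(\<Sum>j<m. ?y j) = (\<Sum>j=1..m. (post_draw lam eta tau e Y m z j - \<theta> j)\<^sup>2)"
    by (simp add: sum.atLeast1_atMost_eq)
  finally have "(\<Sum>j. ?y j) \<le> c" using assms(2) unfolding y tail_def by simp
  then show ?thesis
    using sum unfolding l2ball_def l2sq_def by (simp add: suminf_ennreal2 ennreal_leI)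
qed

text \<open>Exponential Markov inequality, integrating first over the posterior draw and then over
  the data. Each integration doubles the coefficient of the squared mean, hence
  \<open>4 * t\<close>; the variances contribute at most \<open>2 * t\<close> and
  \<open>4 * t\<close> times \<open>e * Lam lam j\<close>, hence \<open>6 * t\<close>. The second
  integration starts from coefficient \<open>2 * t\<close>, which explains the bound 1/8.\<close>

lemma nn_integral_miss:
  assumes "summable (\<lambda>j. (offset (Suc j))\<^sup>2)"
    and R: "R + tail m \<le> c" and t: "0 \<le> t" "\<And>j. j \<in> {1..m} \<Longrightarrow> t * (e * Lam lam j) \<le> 1/8"
  shows "(\<integral>\<^sup>+\<xi>. ennreal (miss m c \<xi>) \<partial>noise)
    \<le> ennreal (exp ((\<Sum>j=1..m. 6 * t * (e * Lam lam j) + 4 * t * ((1 - shrink j) * offset j)\<^sup>2) - t * R))"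
proof -
  interpret N: prob_space noise by (rule prob_space_noise)
  \<comment> \<open>The error of a draw splits into shrinkage bias \<open>b\<close>, data noise with
    signed scale \<open>w\<close>, and posterior noise with variance \<open>v\<close>.\<close>
  define w where "w j = shrink j * (sqrt e / lam j)" for j
  define b where "b j = (shrink j - 1) * offset j" for j
  define v where "v j = sig lam tau e j" for j
  have w2: "(w j)\<^sup>2 \<le> e * Lam lam j" and w0: "w j \<noteq> 0" and v: "0 < v j" "v j \<le> e * Lam lam j"
    if "j \<in> {1..m}" for j
  proof -
    have j: "1 \<le> j" using that by simp
    note s = shrink_pos[OF j] shrink_le_1[OF j]
    have "(w j)\<^sup>2 = (shrink j)\<^sup>2 * (e * Lam lam j)"
      using e by (simp add: w_def Lam_def power_mult_distrib power_divide)
    also have "\<dots> \<le> 1 * (e * Lam lam j)"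
      using s e Lam_pos[OF j] by (intro mult_right_mono) (auto simp: power_le_one)
    finally show "(w j)\<^sup>2 \<le> e * Lam lam j" by simp
    show "w j \<noteq> 0" using s(1) e lam_nz[OF j] by (simp add: w_def)
    show "0 < v j" using sig_pos[OF j] by (simp add: v_def)
    show "v j \<le> e * Lam lam j"
      using s e Lam_pos[OF j] by (simp add: v_def sig_eq[OF j] mult_left_le_one_le)
  qed
  have draw: "post_draw lam eta tau e (obs \<xi>) m z j - \<theta> j = (b j + w j * \<xi> j) + sqrt (v j) * z j"
    if "j \<in> {1..m}" for j \<xi> z
    using that thetaY_minus_eta[of j \<xi>]
    by (auto simp: post_draw_def b_def w_def v_def offset_def algebra_simps)
  have inner: "ennreal (miss m c \<xi>)
    \<le> ennreal (exp (- t * R)) * ennreal (exp (\<Sum>j=1..m. 2 * t * v j + 2 * t * (b j + w j * \<xi> j)\<^sup>2))" for \<xi>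
  proof -
    have "ennreal (miss m c \<xi>) = emeasure noise {z. post_draw lam eta tau e (obs \<xi>) m z \<notin> l2ball \<theta> c}"
      unfolding miss_def by (simp add: N.emeasure_eq_measure)
    also have "\<dots> = (\<integral>\<^sup>+z. indicator {z. post_draw lam eta tau e (obs \<xi>) m z \<notin> l2ball \<theta> c} z \<partial>noise)"
      by (rule nn_integral_indicator[symmetric]) (rule miss_set)
    also have "\<dots> \<le> (\<integral>\<^sup>+z. ennreal (exp (- t * R)) *
        ennreal (exp (\<Sum>j=1..m. t * ((b j + w j * \<xi> j) + sqrt (v j) * z j)\<^sup>2)) \<partial>noise)"
    proof (intro nn_integral_mono)
      fix z
      let ?S = "\<Sum>j=1..m. ((b j + w j * \<xi> j) + sqrt (v j) * z j)\<^sup>2"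
      \<comment> \<open>Off the ball the exponent is nonnegative, so the exponential dominates the
        indicator.\<close>
      have "0 \<le> - t * R + t * ?S" if "post_draw lam eta tau e (obs \<xi>) m z \<notin> l2ball \<theta> c"
      proof -
        have "\<not> (\<Sum>j=1..m. (post_draw lam eta tau e (obs \<xi>) m z j - \<theta> j)\<^sup>2) + tail m \<le> c"
          using l2sq_post_draw_le[OF assms(1)] that by blast
        then have "\<not> ?S + tail m \<le> c" by (simp add: draw)
        then have "R \<le> ?S" using R by simp
        from mult_left_mono[OF this t(1)] show ?thesis by simp
      qed
      then show "indicator {z. post_draw lam eta tau e (obs \<xi>) m z \<notin> l2ball \<theta> c} z
        \<le> ennreal (exp (- t * R)) * ennreal (exp (\<Sum>j=1..m. t * ((b j + w j * \<xi> j) + sqrt (v j) * z j)\<^sup>2))"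
        by (auto simp: indicator_def ennreal_mult'[symmetric] exp_add[symmetric] sum_distrib_left
          simp del: mult_minus_left)
    qed
    also have "\<dots> = ennreal (exp (- t * R)) *
      (\<integral>\<^sup>+z. ennreal (exp (\<Sum>j=1..m. t * ((b j + w j * \<xi> j) + sqrt (v j) * z j)\<^sup>2)) \<partial>noise)"
      by (rule nn_integral_cmult) measurable
    also have "\<dots> \<le> ennreal (exp (- t * R)) * ennreal (exp (\<Sum>j=1..m. 2 * t * v j + 2 * t * (b j + w j * \<xi> j)\<^sup>2))"
    proof (intro mult_left_mono nn_integral_exp_sum_noise_le)
      fix j assume j: "j \<in> {1..m}"
      have "t * v j \<le> t * (e * Lam lam j)" using v[OF j] t(1) by (intro mult_left_mono) auto
      then show "(\<integral>\<^sup>+x. ennreal (exp (t * ((b j + w j * \<xi> j) + sqrt (v j) * x)\<^sup>2)) \<partial>density lborel std_normal_density)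
        \<le> ennreal (exp (2 * t * v j + 2 * t * (b j + w j * \<xi> j)\<^sup>2))"
        using nn_integral_exp_sq_affine_std_normal_le[OF t(1), of "sqrt (v j)" "b j + w j * \<xi> j"] v[OF j] t(2)[OF j]
        by simp
    qed auto
    finally show ?thesis .
  qed
  have "(\<integral>\<^sup>+\<xi>. ennreal (miss m c \<xi>) \<partial>noise)
    \<le> (\<integral>\<^sup>+\<xi>. ennreal (exp (- t * R)) * ennreal (exp (\<Sum>j=1..m. 2 * t * v j + 2 * t * (b j + w j * \<xi> j)\<^sup>2)) \<partial>noise)"
    by (intro nn_integral_mono inner)
  also have "\<dots> = ennreal (exp (- t * R)) *
    (\<integral>\<^sup>+\<xi>. ennreal (exp (\<Sum>j=1..m. 2 * t * v j + 2 * t * (b j + w j * \<xi> j)\<^sup>2)) \<partial>noise)"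
    by (rule nn_integral_cmult) measurable
  also have "\<dots> \<le> ennreal (exp (- t * R)) *
    ennreal (exp (\<Sum>j=1..m. 6 * t * (e * Lam lam j) + 4 * t * (b j)\<^sup>2))"
  proof (intro mult_left_mono nn_integral_exp_sum_noise_le)
    fix j assume j: "j \<in> {1..m}"
    have tw: "t * (w j)\<^sup>2 \<le> t * (e * Lam lam j)" and tv: "t * v j \<le> t * (e * Lam lam j)"
      using w2[OF j] v[OF j] t(1) by (auto intro: mult_left_mono)
    have "(\<integral>\<^sup>+x. ennreal (exp (2 * t * v j + 2 * t * (b j + w j * x)\<^sup>2)) \<partial>density lborel std_normal_density)
      = (\<integral>\<^sup>+x. ennreal (exp (2 * t * v j)) * ennreal (exp (2 * t * (b j + w j * x)\<^sup>2)) \<partial>density lborel std_normal_density)"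
      by (simp add: ennreal_mult'[symmetric] exp_add[symmetric])
    also have "\<dots> = ennreal (exp (2 * t * v j)) * (\<integral>\<^sup>+x. ennreal (exp (2 * t * (b j + w j * x)\<^sup>2)) \<partial>density lborel std_normal_density)"
      by (rule nn_integral_cmult) simp
    also have "\<dots> \<le> ennreal (exp (2 * t * v j)) * ennreal (exp (2 * (2 * t) * (w j)\<^sup>2 + 2 * (2 * t) * (b j)\<^sup>2))"
      using t(1) t(2)[OF j] tw w0[OF j]
      by (intro mult_left_mono nn_integral_exp_sq_affine_std_normal_le) auto
    also have "\<dots> \<le> ennreal (exp (6 * t * (e * Lam lam j) + 4 * t * (b j)\<^sup>2))"
      using tw tv by (auto simp: ennreal_mult'[symmetric] exp_add[symmetric] intro!: ennreal_leI)
    finally show "(\<integral>\<^sup>+x. ennreal (exp (2 * t * v j + 2 * t * (b j + w j * x)\<^sup>2)) \<partial>density lborel std_normal_density)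
      \<le> ennreal (exp (6 * t * (e * Lam lam j) + 4 * t * (b j)\<^sup>2))" .
  qed auto
  also have "\<dots> = ennreal (exp ((\<Sum>j=1..m. 6 * t * (e * Lam lam j) + 4 * t * (b j)\<^sup>2) - t * R))"
    by (simp add: ennreal_mult'[symmetric] exp_add[symmetric])
  also have "(\<lambda>j. (b j)\<^sup>2) = (\<lambda>j. ((1 - shrink j) * offset j)\<^sup>2)"
    by (simp add: b_def power_mult_distrib power2_commute)
  finally show ?thesis .
qed

end

section \<open>The oracle dimension and rate\<close>

locale hier_model =
  fixes lam eta a :: "nat \<Rightarrow> real" and tau :: "real \<Rightarrow> nat \<Rightarrow> real" and d C L r eo :: real
  assumes lam_bdd: "\<exists>B. \<forall>j. \<bar>lam j\<bar> \<le> B"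
    and lam_nz: "\<And>j. 1 \<le> j \<Longrightarrow> lam j \<noteq> 0"
    and tau_pos: "\<And>e j. 0 < e \<Longrightarrow> e < 1 \<Longrightarrow> 1 \<le> j \<Longrightarrow> 0 < tau e j"
    and eo: "0 < eo" "eo < 1"
    and a_pos: "\<And>j. 1 \<le> j \<Longrightarrow> 0 < a j"
    and a_mono: "\<And>j k. 1 \<le> j \<Longrightarrow> j \<le> k \<Longrightarrow> a k \<le> a j"
    and a_1: "a 1 = 1"
    and a_lim: "a \<longlonglongrightarrow> 0"
    and d_pos: "0 < d"
    and assmA: "\<And>e j. 0 < e \<Longrightarrow> e < 1 \<Longrightarrow> j \<in> {1..Geps lam e} \<Longrightarrow>
      d * max (sqrt e * sqrt (Lam lam j)) (e * Lam lam j) \<le> tau e j"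
    and C_ge: "1 \<le> C" and L_ge: "1 \<le> L"
    and assmE1: "\<And>k j. 1 \<le> k \<Longrightarrow> k < j \<Longrightarrow> (lam j)\<^sup>2 \<le> C * Min ((\<lambda>i. (lam i)\<^sup>2) ` {1..k})"
    and assmE2: "\<And>k l. 1 \<le> k \<Longrightarrow> 1 \<le> l \<Longrightarrow> Lmax lam (k * l) \<le> Lmax lam k * Lmax lam l"
    and assmE3: "\<And>k. 1 \<le> k \<Longrightarrow> Lmax lam k / Lbar lam k \<le> L"
    and assmM: "0 < kappastar a lam eo"
    and r_pos: "0 < r"
begin

abbreviation \<kappa> :: real where "\<kappa> \<equiv> kappastar a lam eo"

section \<open>Eigenvalue bounds from Assumption E\<close>

lemma Lam_gt_0: "1 \<le> j \<Longrightarrow> 0 < Lam lam j"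
  using lam_nz by (simp add: Lam_def)

lemma Lam_le_Lmax: "1 \<le> j \<Longrightarrow> j \<le> m \<Longrightarrow> Lam lam j \<le> Lmax lam m"
  unfolding Lmax_def by (intro Max_ge) auto

text \<open>Submultiplicativity at \<open>k = l = 1\<close> says that \<open>Lam lam 1\<close> is at
  most its own square.\<close>

lemma one_le_Lam_1: "1 \<le> Lam lam 1"
  using assmE2[of 1 1] Lam_gt_0[of 1] by (simp add: Lmax_def)

lemma one_le_Lmax: "1 \<le> m \<Longrightarrow> 1 \<le> Lmax lam m"
  using one_le_Lam_1 Lam_le_Lmax[of 1 m] by simp

lemma real_mult_Lbar: "1 \<le> m \<Longrightarrow> real m * Lbar lam m = (\<Sum>j=1..m. Lam lam j)"
  by (simp add: Lbar_def)

lemma Lbar_pos: "1 \<le> m \<Longrightarrow> 0 < Lbar lam m"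
  unfolding Lbar_def by (intro divide_pos_pos sum_pos) (auto intro: Lam_gt_0)

lemma Lbar_le_Lmax: "1 \<le> m \<Longrightarrow> Lbar lam m \<le> Lmax lam m"
  using sum_bounded_above[of "{1..m}" "Lam lam" "Lmax lam m"] Lam_le_Lmax
  by (simp add: Lbar_def divide_le_eq mult.commute)

lemma Lmax_le_Lbar: "1 \<le> m \<Longrightarrow> Lmax lam m \<le> L * Lbar lam m"
  using assmE3[of m] Lbar_pos[of m] by (simp add: divide_le_eq)

lemma Min_sq_le: "1 \<le> m \<Longrightarrow> Min ((\<lambda>i. (lam i)\<^sup>2) ` {1..m}) \<le> 1 / Lmax lam m"
proof -
  assume m: "1 \<le> m"
  have "Lmax lam m \<in> Lam lam ` {1..m}"
    unfolding Lmax_def using m by (intro Max_in) auto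
  then obtain i where "i \<in> {1..m}" "Lmax lam m = Lam lam i" by auto
  then show ?thesis by (auto simp: Lam_def intro!: Min_le)
qed

text \<open>Boundedness of \<open>lam\<close> keeps \<open>Lam\<close> away from 0, so the variance
  term grows at least linearly in the dimension. Beyond some \<open>N\<close> the objective exceeds
  its value at 1, and a minimiser over a finite range is global.\<close>

lemma ex_mstar:
  assumes "0 < e"
  shows "\<exists>m\<ge>1. \<forall>k\<ge>1. max (a m) (e * real m * Lbar lam m) \<le> max (a k) (e * real k * Lbar lam k)"
proof -
  define f where "f k = max (a k) (e * real k * Lbar lam k)" for k
  obtain B where B: "\<And>j. \<bar>lam j\<bar> \<le> B" using lam_bdd by auto
  then have "0 < B" using lam_nz[of 1] abs_ge_zero[of "lam 1"] order.trans[of 0 "\<bar>lam 1\<bar>" B]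
    by (smt (verit) order_refl zero_less_abs_iff)
  have Lam_ge: "1 / B\<^sup>2 \<le> Lam lam j" if "1 \<le> j" for j
    unfolding Lam_def using lam_nz[OF that] B[of j]
    by (intro divide_left_mono) (auto simp: power2_le_iff_abs_le \<open>0 < B\<close> less_imp_le abs_le_square_iff[symmetric])
  have f_ge: "e * (real k / B\<^sup>2) \<le> f k" if "1 \<le> k" for k
  proof -
    have "real k * (1 / B\<^sup>2) \<le> (\<Sum>j=1..k. Lam lam j)"
      using sum_bounded_below[of "{1..k}" "1 / B\<^sup>2" "Lam lam"] Lam_ge by simp
    then have "e * (real k / B\<^sup>2) \<le> e * (real k * Lbar lam k)"
      using assms that by (simp only: real_mult_Lbar) (intro mult_left_mono, auto)
    then show ?thesis by (simp add: f_def mult.assoc)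
  qed
  obtain N :: nat where N: "f 1 * B\<^sup>2 / e < real N" using reals_Archimedean2 by blast
  have out: "f 1 < f k" if "k > N" for k
  proof -
    have "f 1 * B\<^sup>2 / e < real k" using N that by simp
    then have "f 1 < e * (real k / B\<^sup>2)" using assms \<open>0 < B\<close> by (simp add: field_simps)
    also have "\<dots> \<le> f k" using that by (intro f_ge) auto
    finally show ?thesis .
  qed
  define m where "m = arg_min_on f {1..Suc N}"
  have m: "m \<in> {1..Suc N}" and le: "\<And>k. k \<in> {1..Suc N} \<Longrightarrow> f m \<le> f k"
    unfolding m_def by (rule arg_min_if_finite arg_min_least; simp)+
  have "f m \<le> f k" if "1 \<le> k" for k
    using le[of k] le[of 1] out[of k] that by (cases "k \<le> Suc N") auto
  then show ?thesis using m by (auto simp: f_def)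
qed

lemma mstar_ge_1: "0 < e \<Longrightarrow> 1 \<le> mstar a lam e"
  and Phistar_le: "0 < e \<Longrightarrow> 1 \<le> k \<Longrightarrow> Phistar a lam e \<le> max (a k) (e * real k * Lbar lam k)"
proof -
  assume "0 < e"
  from LeastI_ex[OF ex_mstar[OF this, unfolded Bex_def]]
  have *: "1 \<le> mstar a lam e \<and> (\<forall>k\<ge>1. Phistar a lam e \<le> max (a k) (e * real k * Lbar lam k))"
    unfolding Phistar_def mstar_def .
  show "1 \<le> mstar a lam e" using * by simp
  show "Phistar a lam e \<le> max (a k) (e * real k * Lbar lam k)" if "1 \<le> k" using * that by simp
qed

lemma a_mstar_le_Phistar: "a (mstar a lam e) \<le> Phistar a lam e"
  by (simp add: Phistar_def)

lemma Phistar_pos: "0 < e \<Longrightarrow> 0 < Phistar a lam e"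
  using a_pos[OF mstar_ge_1] a_mstar_le_Phistar[of e] by (meson less_le_trans)

lemma variance_mstar_le:
  assumes "0 < e"
  shows "e * real (mstar a lam e) * Lmax lam (mstar a lam e) \<le> L * Phistar a lam e"
proof -
  let ?M = "mstar a lam e"
  have "e * real ?M * Lmax lam ?M \<le> e * real ?M * (L * Lbar lam ?M)"
    using assms mstar_ge_1[OF assms] by (intro mult_left_mono Lmax_le_Lbar) auto
  also have "\<dots> = L * (e * real ?M * Lbar lam ?M)" by simp
  also have "\<dots> \<le> L * Phistar a lam e"
    using L_ge by (intro mult_left_mono) (auto simp: Phistar_def)
  finally show ?thesis .
qed

lemma kappastar_le:
  assumes "0 < e" "e < eo"
  shows "\<kappa> \<le> min (a (mstar a lam e)) (e * real (mstar a lam e) * Lbar lam (mstar a lam e)) / Phistar a lam e"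
  unfolding kappastar_def
proof (rule cInf_lower)
  \<comment> \<open>The real \<open>Inf\<close> is known to be a lower bound only for a set bounded
    below; 0 is such a bound.\<close>
  show "bdd_below ((\<lambda>e. min (a (mstar a lam e)) (e * real (mstar a lam e) * Lbar lam (mstar a lam e))
     / Phistar a lam e) ` {0<..<eo})"
  proof (rule bdd_belowI2)
    fix e :: real assume "e \<in> {0<..<eo}"
    then have e: "0 < e" by simp
    from mstar_ge_1[OF e] Phistar_pos[OF e] e
    show "0 \<le> min (a (mstar a lam e)) (e * real (mstar a lam e) * Lbar lam (mstar a lam e)) / Phistar a lam e"
      by (auto intro!: divide_nonneg_pos mult_nonneg_nonneg less_imp_le[OF a_pos] less_imp_le[OF Lbar_pos])
  qed
qed (use assms in auto)

lemma kappastar_le_1: "\<kappa> \<le> 1"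
proof -
  have e: "0 < eo/2" "eo/2 < eo" using eo by auto
  have "\<kappa> \<le> min (a (mstar a lam (eo/2))) (eo/2 * real (mstar a lam (eo/2)) * Lbar lam (mstar a lam (eo/2))) / Phistar a lam (eo/2)"
    by (rule kappastar_le[OF e])
  also have "\<dots> \<le> 1"
    using Phistar_pos[OF e(1)] a_mstar_le_Phistar[of "eo/2"] by simp
  finally show ?thesis .
qed

text \<open>Balance at the oracle: the bias level is at most the variance level divided by \<kappa>.
  It lets tail energy be measured in units of noise.\<close>

lemma kappastar_a_le:
  assumes "0 < e" "e < eo"
  shows "\<kappa> * a (mstar a lam e) \<le> e * real (mstar a lam e) * Lmax lam (mstar a lam e)"
proof -
  let ?M = "mstar a lam e"
  have "\<kappa> * a ?M \<le> \<kappa> * Phistar a lam e"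
    using assmM by (intro mult_left_mono a_mstar_le_Phistar) auto
  also have "\<dots> \<le> e * real ?M * Lbar lam ?M"
    using kappastar_le[OF assms] Phistar_pos[OF assms(1)] by (simp add: pos_le_divide_eq)
  also have "\<dots> \<le> e * real ?M * Lmax lam ?M"
    using assms mstar_ge_1[OF assms(1)] by (intro mult_left_mono Lbar_le_Lmax) auto
  finally show ?thesis .
qed

text \<open>The objective at any fixed \<open>k\<close> dominates the minimum: choose
  \<open>k\<close> with \<open>a k\<close> small, then let the variance term at \<open>k\<close>
  vanish with the noise.\<close>

lemma Phistar_tendsto_0: "(Phistar a lam \<longlongrightarrow> 0) (at_right 0)"
proof (rule order_tendstoI)
  fix y :: real assume "y < 0"
  then show "\<forall>\<^sub>F e in at_right 0. y < Phistar a lam e"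
    using eventually_at_right_less[of "0::real"] Phistar_pos by (auto elim!: eventually_mono intro: less_trans)
next
  fix y :: real assume "0 < y"
  then have "\<forall>\<^sub>F k in sequentially. a k < y \<and> 1 \<le> k"
    using order_tendstoD(2)[OF a_lim] eventually_ge_at_top[of 1] by (auto intro: eventually_conj)
  then obtain k where k: "a k < y" "1 \<le> k" by (auto simp: eventually_sequentially)
  have "((\<lambda>e. e * real k * Lbar lam k) \<longlongrightarrow> 0 * real k * Lbar lam k) (at_right 0)"
    by (intro tendsto_intros)
  then have "\<forall>\<^sub>F e in at_right 0. e * real k * Lbar lam k < y"
    using \<open>0 < y\<close> by (intro order_tendstoD(2)) auto
  then show "\<forall>\<^sub>F e in at_right 0. Phistar a lam e < y"
    using eventually_at_right_less[of "0::real"]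
  proof eventually_elim
    case (elim e)
    then show ?case using Phistar_le[of e k] k by simp
  qed
qed

text \<open>\<open>a\<close> at the oracle is at most the vanishing rate, whereas \<open>a\<close>
  is positive at every fixed index; \<open>Suc N\<close> avoids the meaningless index 0.\<close>

lemma mstar_at_top: "filterlim (mstar a lam) at_top (at_right 0)"
  unfolding filterlim_at_top
proof
  fix N :: nat
  have "\<forall>\<^sub>F e in at_right 0. Phistar a lam e < a (Suc N)"
    by (rule order_tendstoD(2)[OF Phistar_tendsto_0]) (simp add: a_pos)
  then show "\<forall>\<^sub>F e in at_right 0. N \<le> mstar a lam e"
    using eventually_at_right_less[of "0::real"]
  proof eventually_elim
    case (elim e)
    then have "a (mstar a lam e) < a (Suc N)" using a_mstar_le_Phistar[of e] by simp
    then show ?case using a_mono[of "mstar a lam e" "Suc N"] mstar_ge_1[of e] elim by (rule_tac ccontr) auto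
  qed
qed

text \<open>Once the rate is below \<open>1 / L\<close>, the product of \<open>e\<close>, the oracle
  dimension and its \<open>Lmax\<close> is at most 1. As the last two are at least 1, both
  constraints defining \<open>Geps\<close> follow.\<close>

lemma eventually_mstar_le_Geps: "\<forall>\<^sub>F e in at_right 0. mstar a lam e \<le> Geps lam e"
proof -
  have "\<forall>\<^sub>F e in at_right 0. Phistar a lam e < 1 / L"
    by (rule order_tendstoD(2)[OF Phistar_tendsto_0]) (use L_ge in auto)
  then show ?thesis
    using eventually_at_right_less[of "0::real"]
  proof eventually_elim
    case (elim e)
    let ?M = "mstar a lam e"
    note M = mstar_ge_1[OF elim(2)]
    have "L * Phistar a lam e \<le> 1" using elim(1) L_ge by (simp add: field_simps)
    then have le: "e * real ?M * Lmax lam ?M \<le> 1" using variance_mstar_le[OF elim(2)] by simp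
    have "e * real ?M * 1 \<le> e * real ?M * Lmax lam ?M"
      using elim(2) one_le_Lmax[OF M] by (intro mult_left_mono) auto
    then have "e * real ?M \<le> 1" using le by simp
    then have "real ?M \<le> 1 / e" using elim(2) by (simp add: field_simps)
    then have 1: "?M \<le> nat \<lfloor>1 / e\<rfloor>" by (rule le_nat_floor)
    have "e * Lmax lam ?M * 1 \<le> e * Lmax lam ?M * real ?M"
      using elim(2) one_le_Lmax[OF M] M by (intro mult_left_mono) auto
    then have "e * Lmax lam ?M \<le> Lam lam 1" using le one_le_Lam_1 by (simp add: mult_ac)
    with 1 M show ?case unfolding Geps_def by (intro Max_ge) auto
  qed
qed

end

section \<open>Concentration at a fixed noise level\<close>

context hier_model
begin

text \<open>At the oracle dimension this is the \<delta> of the overview.\<close>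

definition energy :: "(nat \<Rightarrow> real) \<Rightarrow> nat \<Rightarrow> real" where
  "energy \<theta> m = (\<Sum>j. (\<theta> (Suc (j + m)) - eta (Suc (j + m)))\<^sup>2 / a (Suc (j + m)))"

lemma Theta_summable:
  assumes "\<theta> \<in> Theta a eta r"
  shows "summable (\<lambda>j. (\<theta> (Suc j) - eta (Suc j))\<^sup>2 / a (Suc j))"
    and "(\<Sum>j. (\<theta> (Suc j) - eta (Suc j))\<^sup>2 / a (Suc j)) \<le> r"
proof -
  let ?g = "\<lambda>j. (\<theta> (Suc j) - eta (Suc j))\<^sup>2 / a (Suc j)"
  have g: "0 \<le> ?g j" for j using a_pos[of "Suc j"] by simp
  have le: "(\<Sum>j. ennreal (?g j)) \<le> ennreal r" using assms by (simp add: Theta_def)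
  show *: "summable ?g"
  proof (rule summable_suminf_not_top[OF g])
    show "(\<Sum>j. ennreal (?g j)) \<noteq> top" using le ennreal_less_top by (metis neq_top_trans ennreal_neq_top)
  qed
  have "ennreal (suminf ?g) \<le> ennreal r"
    using le suminf_ennreal2[OF g *] by simp
  then show "suminf ?g \<le> r" using r_pos by (simp add: ennreal_le_iff)
qed

lemma energy_le:
  assumes "\<theta> \<in> Theta a eta r"
  shows "energy \<theta> m \<le> r"
proof -
  let ?g = "\<lambda>j. (\<theta> (Suc j) - eta (Suc j))\<^sup>2 / a (Suc j)"
  have "energy \<theta> m = suminf ?g - sum ?g {..<m}"
    unfolding energy_def using suminf_minus_initial_segment[OF Theta_summable(1)[OF assms]] by simp
  also have "\<dots> \<le> r - 0"
    using a_pos by (intro diff_mono Theta_summable(2)[OF assms] sum_nonneg) (auto simp: less_imp_le)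
  finally show ?thesis by simp
qed

lemma energy_tendsto_0:
  assumes "\<theta> \<in> Theta a eta r"
  shows "energy \<theta> \<longlonglongrightarrow> 0"
proof -
  let ?g = "\<lambda>j. (\<theta> (Suc j) - eta (Suc j))\<^sup>2 / a (Suc j)"
  have "(\<lambda>m. suminf ?g - sum ?g {..<m}) \<longlonglongrightarrow> suminf ?g - suminf ?g"
    by (intro tendsto_intros summable_LIMSEQ Theta_summable(1)[OF assms])
  then show ?thesis
    unfolding energy_def using suminf_minus_initial_segment[OF Theta_summable(1)[OF assms]] by simp
qed

end

locale hier_model_at = hier_model +
  fixes e :: real and \<theta> :: "nat \<Rightarrow> real"
  assumes e_range: "0 < e" "e < eo" and theta: "\<theta> \<in> Theta a eta r"
begin

sublocale S: sieve_model lam eta tau e \<theta> C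
  using e_range eo lam_nz tau_pos by unfold_locales auto

abbreviation M :: nat where "M \<equiv> mstar a lam e"
abbreviation \<Phi> :: real where "\<Phi> \<equiv> Phistar a lam e"

text \<open>All three follow from monotonicity of \<open>a\<close>: each squared offset is
  \<open>a\<close> times its share of the ellipsoid sum, and \<open>a\<close> is at most
  \<open>a m\<close> beyond \<open>m\<close> and at most \<open>a 1 = 1\<close> everywhere.\<close>

lemma summable_offset_sq: "summable (\<lambda>j. (S.offset (Suc j))\<^sup>2)"
  and tail_le_energy: "1 \<le> m \<Longrightarrow> S.tail m \<le> a m * energy \<theta> m"
  and tail_0_le: "S.tail 0 \<le> r"
proof -
  let ?g = "\<lambda>j. (\<theta> (Suc j) - eta (Suc j))\<^sup>2 / a (Suc j)"
  have sq: "(S.offset (Suc j))\<^sup>2 = a (Suc j) * ?g j" for j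
    using a_pos[of "Suc j"] by (simp add: S.offset_def)
  have g: "0 \<le> ?g j" for j using a_pos[of "Suc j"] by simp
  have le: "(S.offset (Suc j))\<^sup>2 \<le> 1 * ?g j" for j
    unfolding sq using a_mono[of 1 "Suc j"] a_1 by (intro mult_right_mono g) auto
  note sg = Theta_summable[OF theta]
  show *: "summable (\<lambda>j. (S.offset (Suc j))\<^sup>2)"
    by (rule summable_comparison_test[OF _ sg(1)]) (use le in auto)
  have "S.tail 0 \<le> suminf ?g"
    unfolding S.tail_def using * sg(1) le by (simp add: suminf_le)
  then show "S.tail 0 \<le> r" using sg(2) by simp
  assume m: "1 \<le> m"
  have sg': "summable (\<lambda>j. ?g (j + m))" using sg(1) by (subst summable_iff_shift)
  have "S.tail m \<le> (\<Sum>j. a m * ?g (j + m))"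
    unfolding S.tail_def
  proof (rule suminf_le)
    show "(S.offset (Suc (j + m)))\<^sup>2 \<le> a m * ?g (j + m)" for j
      unfolding sq using m by (intro mult_right_mono g a_mono) auto
    show "summable (\<lambda>j. (S.offset (Suc (j + m)))\<^sup>2)"
      using summable_ignore_initial_segment[OF *, of m] by simp
    show "summable (\<lambda>j. a m * ?g (j + m))" using sg' by (rule summable_mult)
  qed
  also have "\<dots> = a m * energy \<theta> m"
    unfolding energy_def by (rule suminf_mult[OF sg'])
  finally show "S.tail m \<le> a m * energy \<theta> m" .
qed

lemma tail_diff: "m \<le> k \<Longrightarrow> S.tail m - S.tail k = (\<Sum>j\<in>{m<..k}. (S.offset j)\<^sup>2)"
proof -
  assume mk: "m \<le> k"
  let ?x = "\<lambda>j. (S.offset (Suc j))\<^sup>2"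
  have t: "S.tail n = suminf ?x - sum ?x {..<n}" for n
    unfolding S.tail_def using suminf_minus_initial_segment[OF summable_offset_sq] by simp
  have "S.tail m - S.tail k = sum ?x {..<k} - sum ?x {..<m}" by (simp add: t)
  also have "\<dots> = sum ?x ({..<k} - {..<m})" using mk by (subst sum_diff) auto
  also have "\<dots> = sum (\<lambda>j. (S.offset j)\<^sup>2) (Suc ` ({..<k} - {..<m}))"
    by (subst sum.reindex) auto
  also have "Suc ` ({..<k} - {..<m}) = {m<..k}"
    by (auto simp: image_iff)
  finally show ?thesis .
qed

lemma tail_nonneg: "0 \<le> S.tail m"
  unfolding S.tail_def using summable_ignore_initial_segment[OF summable_offset_sq, of m]
  by (intro suminf_nonneg) auto

text \<open>The ratio equals \<open>1 / (2 + v)\<close> with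
  \<open>v = e * Lam lam j / tau e j\<close>, and the second branch of the maximum in Assumption A
  gives \<open>v \<le> 1 / d\<close>.\<close>

lemma shrink_ratio_ge:
  assumes "j \<in> {1..Geps lam e}"
  shows "d / (2*d + 1) \<le> S.shrink j / (1 + S.shrink j)"
proof -
  have j: "1 \<le> j" using assms by simp
  note p = tau_pos[OF S.e j]
  have "d * (e * Lam lam j) \<le> tau e j"
    using assmA[OF S.e assms] d_pos by (smt (verit) mult_left_mono max.cobounded2)
  then have u: "e * Lam lam j / tau e j \<le> 1 / d" "0 \<le> e * Lam lam j / tau e j"
    using p d_pos S.e S.Lam_pos[OF j] by (auto simp: field_simps)
  have "1 / (1 + v) / (1 + 1 / (1 + v)) = 1 / (2 + v)" if "0 \<le> v" for v :: real
    using that by (simp add: divide_simps)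
  from this[OF u(2)] have "S.shrink j / (1 + S.shrink j) = 1 / (2 + e * Lam lam j / tau e j)"
    unfolding S.shrink_def .
  also have "\<dots> \<ge> 1 / (2 + 1 / d)"
    using u d_pos by (intro divide_left_mono) (auto intro!: mult_pos_pos add_pos_nonneg)
  also have "1 / (2 + 1 / d) = d / (2*d + 1)" using d_pos by (simp add: field_simps)
  finally show ?thesis .
qed

text \<open>The first branch of the maximum in Assumption A is used here. It makes the squared
  shrinkage factor of order the noise variance, so the shrinkage bias stays below the rate.\<close>

lemma one_minus_shrink_sq_le:
  assumes "j \<in> {1..Geps lam e}"
  shows "(1 - S.shrink j)\<^sup>2 \<le> e * Lam lam j / d\<^sup>2"
proof -
  have j: "1 \<le> j" using assms by simp
  define u where "u = e * Lam lam j"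
  have u: "0 < u" using S.e S.Lam_pos[OF j] by (simp add: u_def)
  note p = tau_pos[OF S.e j]
  have t: "d * sqrt u \<le> tau e j"
    using assmA[OF S.e assms] d_pos unfolding u_def real_sqrt_mult
    by (smt (verit) mult_left_mono max.cobounded1)
  have "1 - S.shrink j = (u / tau e j) / (1 + u / tau e j)"
    unfolding S.shrink_def u_def[symmetric] using u p by (simp add: field_simps add_pos_pos)
  also have "\<dots> \<le> (u / tau e j) / 1"
    using u p by (intro divide_left_mono) (auto intro!: add_pos_pos)
  also have "\<dots> \<le> u / (d * sqrt u)"
    using u t d_pos p by (auto intro!: divide_left_mono mult_pos_pos)
  also have "\<dots> = u / sqrt u / d" by simp
  also have "\<dots> = sqrt u / d" using u by (simp only: real_div_sqrt[OF less_imp_le])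
  finally have "(1 - S.shrink j)\<^sup>2 \<le> (sqrt u / d)\<^sup>2"
    using S.shrink_le_1[OF j] by (intro power_mono) auto
  then show ?thesis using u by (simp add: power_divide u_def)
qed

lemma snr_sq: "1 \<le> j \<Longrightarrow> (S.snr j)\<^sup>2 = (S.offset j)\<^sup>2 / (e * Lam lam j)"
  using S.e by (simp add: S.snr_def Lam_def power_mult_distrib power_divide)

text \<open>Each coordinate beyond \<open>M\<close> costs at least \<open>C / 4\<close> in the
  exponent, because \<open>1/2 - 3*C/4 \<le> - C/4\<close>. The total signal there is at most
  \<open>C * \<delta> * M / \<kappa>\<close>, by Assumption E (i) and the balance at the oracle.
  With at least \<open>(2 + 2*\<delta>/\<kappa>) * M\<close> extra coordinates the cost pays for
  half of that signal and leaves \<open>C * M / 2\<close>.\<close>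

lemma postM_large_dimension:
  assumes M: "M \<le> Geps lam e" and \<delta>: "0 \<le> \<delta>" "energy \<theta> M \<le> \<delta>"
    and D: "3 + 2 * \<delta> / \<kappa> \<le> real D" and m: "m \<in> {1..Geps lam e}" "D * M \<le> m"
  shows "(\<integral>\<^sup>+\<xi>. ennreal (postM lam eta tau C e (S.obs \<xi>) m) \<partial>noise) \<le> ennreal (exp (- (C * real M / 2)))"
proof -
  note M1 = mstar_ge_1[OF e_range(1)]
  have "0 \<le> 2 * \<delta> / \<kappa>" using \<delta> assmM by simp
  then have "1 \<le> D" using D by linarith
  then have "1 * M \<le> D * M" by (intro mult_le_mono) auto
  then have Mm: "M \<le> m" using m(2) by linarith
  have pos: "0 < e * Lmax lam M" using e_range one_le_Lmax[OF M1] by (intro mult_pos_pos) auto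
  have "S.tail M \<le> a M * \<delta>"
    using order_trans[OF tail_le_energy[OF M1] mult_left_mono[OF \<delta>(2)]] a_pos[OF M1] by simp
  then have "\<kappa> * S.tail M \<le> \<delta> * (\<kappa> * a M)"
    using assmM by (simp add: mult_ac mult_left_mono)
  also have "\<dots> \<le> \<delta> * (e * real M * Lmax lam M)"
    by (intro mult_left_mono kappastar_a_le e_range \<delta>)
  finally have "\<kappa> * S.tail M \<le> \<delta> * (e * real M * Lmax lam M)" .
  then have tail: "S.tail M / (e * Lmax lam M) \<le> \<delta> * real M / \<kappa>"
    using pos assmM by (simp add: field_simps)
  have snr: "(S.snr j)\<^sup>2 \<le> C / (e * Lmax lam M) * (S.offset j)\<^sup>2" if "j \<in> {M<..m}" for j
  proof -
    have "(lam j)\<^sup>2 \<le> C * (1 / Lmax lam M)"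
      using assmE1[OF M1, of j] Min_sq_le[OF M1] that C_ge
      by (smt (verit) greaterThanAtMost_iff mult_left_mono)
    then have "(lam j)\<^sup>2 * ((S.offset j)\<^sup>2 / e) \<le> C * (1 / Lmax lam M) * ((S.offset j)\<^sup>2 / e)"
      using e_range by (intro mult_right_mono) auto
    then show ?thesis using e_range by (simp add: S.snr_def power_mult_distrib power_divide mult_ac)
  qed
  have "(\<Sum>j\<in>{M<..m}. (S.snr j)\<^sup>2) \<le> (\<Sum>j\<in>{M<..m}. C / (e * Lmax lam M) * (S.offset j)\<^sup>2)"
    by (intro sum_mono snr)
  also have "\<dots> = C / (e * Lmax lam M) * (S.tail M - S.tail m)"
    by (simp add: tail_diff[OF Mm] sum_distrib_left)
  also have "\<dots> \<le> C / (e * Lmax lam M) * S.tail M"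
    using pos C_ge tail_nonneg[of m] by (intro mult_left_mono) auto
  also have "\<dots> = C * (S.tail M / (e * Lmax lam M))" by simp
  also have "\<dots> \<le> C * (\<delta> * real M / \<kappa>)"
    using C_ge by (intro mult_left_mono tail) auto
  finally have sum: "(\<Sum>j\<in>{M<..m}. (S.snr j)\<^sup>2) \<le> C * (\<delta> * real M / \<kappa>)" .
  have "(2 + 2 * \<delta> / \<kappa>) * real M \<le> (real D - 1) * real M" using D by (intro mult_right_mono) auto
  also have "\<dots> \<le> real (m - M)" using m(2) Mm by (simp add: of_nat_diff algebra_simps flip: of_nat_mult)
  finally have mM: "(2 + 2 * \<delta> / \<kappa>) * real M \<le> real (m - M)" .
  have "(\<Sum>j\<in>{M<..m}. 1/2 + (S.snr j)\<^sup>2 / 2 - 3 * C / 4)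
    = real (m - M) * (1/2 - 3 * C / 4) + (\<Sum>j\<in>{M<..m}. (S.snr j)\<^sup>2) / 2"
    by (simp add: sum.distrib sum_subtractf sum_divide_distrib algebra_simps)
  also have "\<dots> \<le> real (m - M) * (- C / 4) + C * (\<delta> * real M / \<kappa>) / 2"
    using sum C_ge by (intro add_mono mult_left_mono) auto
  also have "\<dots> \<le> (2 + 2 * \<delta> / \<kappa>) * real M * (- C / 4) + C * (\<delta> * real M / \<kappa>) / 2"
    using mult_right_mono[OF mM, of "C / 4"] C_ge by simp
  also have "\<dots> = - (C * real M / 2)" using assmM by (simp add: field_simps)
  finally have "exp (\<Sum>j\<in>{M<..m}. 1/2 + (S.snr j)\<^sup>2 / 2 - 3 * C / 4) \<le> exp (- (C * real M / 2))" by simp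
  then show ?thesis
    using S.nn_integral_postM_above[of M m] M M1 Mm m
    by (intro order_trans[OF S.nn_integral_postM_above[of M m]] ennreal_leI) auto
qed

text \<open>The bias that \<open>m\<close> omits and \<open>M\<close> captures exceeds
  \<open>(B - \<delta>) * \<Phi>\<close>, which in noise units is a signal of at least
  \<open>7 * C * (1 + 1/d) * M\<close>. After shrinkage and halving, \<open>7/4 * C * M\<close>
  remains against a penalty gain of at most \<open>3/2 * C * M\<close>; the difference is the
  exponent.\<close>

lemma postM_small_dimension:
  assumes M: "M \<le> Geps lam e" and \<delta>: "0 \<le> \<delta>" "energy \<theta> M \<le> \<delta>"
    and B: "7 * L * C * (1 + 1/d) + \<delta> \<le> B" and m: "m \<le> M" "B * \<Phi> < S.tail m"
  shows "(\<integral>\<^sup>+\<xi>. ennreal (postM lam eta tau C e (S.obs \<xi>) m) \<partial>noise) \<le> ennreal (exp (- (C * real M / 4)))"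
proof -
  note M1 = mstar_ge_1[OF e_range(1)]
  have pos: "0 < e * Lmax lam M" using e_range one_le_Lmax[OF M1] by (intro mult_pos_pos) auto
  have "S.tail M \<le> a M * \<delta>"
    using order_trans[OF tail_le_energy[OF M1] mult_left_mono[OF \<delta>(2)]] a_pos[OF M1] by simp
  also have "\<dots> \<le> \<Phi> * \<delta>" by (intro mult_right_mono a_mstar_le_Phistar \<delta>)
  finally have "(B - \<delta>) * \<Phi> \<le> (\<Sum>j\<in>{m<..M}. (S.offset j)\<^sup>2)"
    unfolding tail_diff[OF m(1), symmetric] using m(2) by (simp add: algebra_simps)
  moreover have "7 * L * C * (1 + 1/d) * \<Phi> \<le> (B - \<delta>) * \<Phi>"
    using B Phistar_pos[OF e_range(1)] by (intro mult_right_mono) auto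
  moreover have "7 * C * (1 + 1/d) * (e * real M * Lmax lam M) \<le> 7 * C * (1 + 1/d) * (L * \<Phi>)"
    using C_ge d_pos by (intro mult_left_mono variance_mstar_le e_range) auto
  ultimately have "7 * C * (1 + 1/d) * real M * (e * Lmax lam M) \<le> (\<Sum>j\<in>{m<..M}. (S.offset j)\<^sup>2)"
    by (simp add: mult_ac)
  then have "7 * C * (1 + 1/d) * real M \<le> (\<Sum>j\<in>{m<..M}. (S.offset j)\<^sup>2) / (e * Lmax lam M)"
    using pos by (simp only: pos_le_divide_eq)
  also have "\<dots> \<le> (\<Sum>j\<in>{m<..M}. (S.snr j)\<^sup>2)"
    unfolding sum_divide_distrib
  proof (intro sum_mono)
    fix j assume j: "j \<in> {m<..M}"
    then have "e * Lam lam j \<le> e * Lmax lam M" using e_range by (intro mult_left_mono Lam_le_Lmax) auto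
    then show "(S.offset j)\<^sup>2 / (e * Lmax lam M) \<le> (S.snr j)\<^sup>2"
      using j e_range S.Lam_pos[of j] by (auto simp: snr_sq intro!: divide_left_mono mult_pos_pos pos)
  qed
  finally have sum: "7 * C * (1 + 1/d) * real M \<le> (\<Sum>j\<in>{m<..M}. (S.snr j)\<^sup>2)" .
  have "d / (2*d + 1) * (1 + 1/d) = d * (1 + 1/d) / (2*d + 1)" by simp
  also have "d * (1 + 1/d) = d + 1" using d_pos by (simp add: distrib_left)
  \<comment> \<open>The factor \<open>1 + 1/d\<close> is there to offset the shrinkage ratio: the
    product is \<open>(d + 1) / (2*d + 1)\<close>.\<close>
  finally have half: "1/2 \<le> d / (2*d + 1) * (1 + 1/d)" using d_pos by (simp add: pos_le_divide_eq)
  have "7/2 * (C * real M) \<le> d / (2*d + 1) * (1 + 1/d) * (7 * (C * real M))"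
    using mult_right_mono[OF half, of "7 * (C * real M)"] C_ge by simp
  also have "\<dots> = d / (2*d + 1) * (7 * C * (1 + 1/d) * real M)" by simp
  also have "\<dots> \<le> d / (2*d + 1) * (\<Sum>j\<in>{m<..M}. (S.snr j)\<^sup>2)"
    using d_pos by (intro mult_left_mono sum) auto
  finally have low: "7/2 * (C * real M) \<le> d / (2*d + 1) * (\<Sum>j\<in>{m<..M}. (S.snr j)\<^sup>2)" .
  have "(\<Sum>j\<in>{m<..M}. 3 * C / 2 - (S.shrink j / 2) * (S.snr j)\<^sup>2 / (1 + S.shrink j))
    \<le> (\<Sum>j\<in>{m<..M}. 3 * C / 2 - d / (2*d + 1) * (S.snr j)\<^sup>2 / 2)"
  proof (intro sum_mono)
    fix j assume "j \<in> {m<..M}"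
    then have j: "j \<in> {1..Geps lam e}" using M by auto
    have eq: "(S.shrink j / 2) * (S.snr j)\<^sup>2 / (1 + S.shrink j) = S.shrink j / (1 + S.shrink j) * (S.snr j)\<^sup>2 / 2"
      by simp
    show "3 * C / 2 - (S.shrink j / 2) * (S.snr j)\<^sup>2 / (1 + S.shrink j)
      \<le> 3 * C / 2 - d / (2*d + 1) * (S.snr j)\<^sup>2 / 2"
      unfolding eq by (intro diff_left_mono divide_right_mono mult_right_mono shrink_ratio_ge[OF j]) auto
  qed
  also have "\<dots> = real (M - m) * (3 * C / 2) - d / (2*d + 1) * (\<Sum>j\<in>{m<..M}. (S.snr j)\<^sup>2) / 2"
    by (simp add: sum_subtractf sum_distrib_left sum_divide_distrib)
  also have "\<dots> \<le> real M * (3 * C / 2) - 7/2 * (C * real M) / 2"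
    using low C_ge by (intro diff_mono mult_right_mono divide_right_mono) auto
  also have "\<dots> = - (C * real M / 4)" by simp
  finally have "exp (\<Sum>j\<in>{m<..M}. 3 * C / 2 - (S.shrink j / 2) * (S.snr j)\<^sup>2 / (1 + S.shrink j))
    \<le> exp (- (C * real M / 4))" by simp
  then show ?thesis
    using M M1 m by (intro order_trans[OF S.nn_integral_postM_below[of M m]] ennreal_leI) auto
qed

text \<open>Submultiplicativity of \<open>Lmax\<close> keeps every noise variance up to dimension
  \<open>D * M\<close> below \<open>Q * \<Phi> / M\<close>, so the total variance is at most
  \<open>D * Q * \<Phi>\<close>. Bias, variance and shrinkage then fit into the radius with \<Phi>
  to spare, and Chernoff's bound gives \<open>exp (- t * \<Phi>)\<close>.\<close>

lemma miss_moderate_dimension: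
  assumes m: "m \<in> {1..Geps lam e}" "m \<le> D * M" and D: "1 \<le> D" and B: "S.tail m \<le> B * \<Phi>"
    and K: "B + 6 * (real D * Lmax lam D * L) + 2 \<le> K"
    and M: "4 * r * Lmax lam D * L / d\<^sup>2 \<le> real M"
  shows "(\<integral>\<^sup>+\<xi>. ennreal (S.miss m (K * \<Phi>) \<xi>) \<partial>noise) \<le> ennreal (exp (- (real M / (8 * Lmax lam D * L))))"
proof -
  note M1 = mstar_ge_1[OF e_range(1)] and \<Phi> = Phistar_pos[OF e_range(1)]
  define Q where "Q = Lmax lam D * L"
  have Q: "1 \<le> Q" using mult_mono[OF one_le_Lmax[OF D] L_ge] one_le_Lmax[OF D] by (simp add: Q_def)
  \<comment> \<open>The largest \<open>t\<close> for which the bound \<open>var\<close> guarantees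
    \<open>t * (e * Lam lam j) \<le> 1/8\<close>.\<close>
  define t where "t = real M / (8 * Q * \<Phi>)"
  have t: "0 < t" using Q \<Phi> M1 by (simp add: t_def)
  have var: "real M * (e * Lam lam j) \<le> Q * \<Phi>" if "j \<in> {1..m}" for j
  proof -
    have "Lam lam j \<le> Lmax lam (D * M)" using that m by (intro Lam_le_Lmax) auto
    also have "\<dots> \<le> Lmax lam D * Lmax lam M" by (rule assmE2[OF D M1])
    finally have "real M * (e * Lam lam j) \<le> real M * (e * (Lmax lam D * Lmax lam M))"
      using e_range by (intro mult_left_mono) auto
    also have "\<dots> = Lmax lam D * (e * real M * Lmax lam M)" by simp
    also have "\<dots> \<le> Lmax lam D * (L * \<Phi>)"
      using one_le_Lmax[OF D] by (intro mult_left_mono variance_mstar_le e_range) auto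
    finally show ?thesis by (simp add: Q_def)
  qed
  have "(\<Sum>j=1..m. real M * (e * Lam lam j)) \<le> real m * (Q * \<Phi>)"
    using sum_bounded_above[of "{1..m}" "\<lambda>j. real M * (e * Lam lam j)" "Q * \<Phi>"] var by simp
  also have "\<dots> \<le> real (D * M) * (Q * \<Phi>)"
    using m Q \<Phi> by (intro mult_right_mono) (auto simp del: of_nat_mult)
  finally have "real M * (\<Sum>j=1..m. e * Lam lam j) \<le> real M * (real D * Q * \<Phi>)"
    by (simp only: sum_distrib_left of_nat_mult mult_ac)
  then have sumvar: "(\<Sum>j=1..m. e * Lam lam j) \<le> real D * Q * \<Phi>"
    using M1 by (subst (asm) mult_le_cancel_left_pos) auto
  have "(\<Sum>j=1..m. ((1 - S.shrink j) * S.offset j)\<^sup>2) \<le> (\<Sum>j=1..m. Q * \<Phi> / (d\<^sup>2 * real M) * (S.offset j)\<^sup>2)"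
  proof (intro sum_mono)
    fix j assume j: "j \<in> {1..m}"
    then have "(1 - S.shrink j)\<^sup>2 \<le> e * Lam lam j / d\<^sup>2" using m by (intro one_minus_shrink_sq_le) auto
    also have "\<dots> \<le> Q * \<Phi> / (d\<^sup>2 * real M)"
      using var[OF j] M1 d_pos by (simp add: field_simps)
    finally show "((1 - S.shrink j) * S.offset j)\<^sup>2 \<le> Q * \<Phi> / (d\<^sup>2 * real M) * (S.offset j)\<^sup>2"
      unfolding power_mult_distrib by (intro mult_right_mono) auto
  qed
  also have "\<dots> = Q * \<Phi> / (d\<^sup>2 * real M) * (S.tail 0 - S.tail m)"
    unfolding sum_distrib_left[symmetric]
    by (subst tail_diff) (auto intro!: sum.cong simp: Suc_le_eq)
  also have "\<dots> \<le> Q * \<Phi> / (d\<^sup>2 * real M) * r"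
    using tail_0_le tail_nonneg[of m] Q \<Phi> by (intro mult_left_mono) auto
  \<comment> \<open>This is where \<open>M\<close> has to be large compared with \<open>r\<close>,
    so that \<open>r\<close> stays out of the radius constant.\<close>
  also have "\<dots> \<le> \<Phi> / 4"
    using M M1 d_pos \<Phi> by (simp add: field_simps Q_def mult_left_mono)
  finally have bias: "(\<Sum>j=1..m. ((1 - S.shrink j) * S.offset j)\<^sup>2) \<le> \<Phi> / 4" .
  have "(\<integral>\<^sup>+\<xi>. ennreal (S.miss m (K * \<Phi>) \<xi>) \<partial>noise)
    \<le> ennreal (exp ((\<Sum>j=1..m. 6 * t * (e * Lam lam j) + 4 * t * ((1 - S.shrink j) * S.offset j)\<^sup>2)
        - t * ((K - B) * \<Phi>)))"
  proof (rule S.nn_integral_miss[OF summable_offset_sq])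
    show "(K - B) * \<Phi> + S.tail m \<le> K * \<Phi>" using B by (simp add: algebra_simps)
    show "t * (e * Lam lam j) \<le> 1/8" if "j \<in> {1..m}" for j
      using var[OF that] Q \<Phi> by (simp add: t_def field_simps)
  qed (use t in simp)
  also have "\<dots> \<le> ennreal (exp (- (real M / (8 * Lmax lam D * L))))"
  proof (intro ennreal_leI, simp only: exp_le_cancel_iff)
    have "(\<Sum>j=1..m. 6 * t * (e * Lam lam j) + 4 * t * ((1 - S.shrink j) * S.offset j)\<^sup>2) - t * ((K - B) * \<Phi>)
      = t * (6 * (\<Sum>j=1..m. e * Lam lam j) + 4 * (\<Sum>j=1..m. ((1 - S.shrink j) * S.offset j)\<^sup>2) - (K - B) * \<Phi>)"
      by (simp add: sum.distrib sum_distrib_left algebra_simps)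
    also have "\<dots> \<le> t * (- \<Phi>)"
    proof (intro mult_left_mono)
      have "(6 * (real D * Q) + 2) * \<Phi> \<le> (K - B) * \<Phi>"
        using K \<Phi> by (intro mult_right_mono) (auto simp: Q_def mult_ac)
      then show "6 * (\<Sum>j=1..m. e * Lam lam j) + 4 * (\<Sum>j=1..m. ((1 - S.shrink j) * S.offset j)\<^sup>2) - (K - B) * \<Phi> \<le> - \<Phi>"
        using sumvar bias by (simp add: algebra_simps)
    qed (use t in simp)
    also have "\<dots> = - (real M / (8 * Lmax lam D * L))"
      using \<Phi> by (simp add: t_def Q_def)
    finally show "(\<Sum>j=1..m. 6 * t * (e * Lam lam j) + 4 * t * ((1 - S.shrink j) * S.offset j)\<^sup>2) - t * ((K - B) * \<Phi>)
      \<le> - (real M / (8 * Lmax lam D * L))" .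
  qed
  finally show ?thesis .
qed

lemma exp_post_concentration:
  assumes M: "M \<le> Geps lam e" "4 * r * Lmax lam D * L / d\<^sup>2 \<le> real M"
    and \<delta>: "0 \<le> \<delta>" "energy \<theta> M \<le> \<delta>" and D: "3 + 2 * \<delta> / \<kappa> \<le> real D"
    and B: "7 * L * C * (1 + 1/d) + \<delta> \<le> B" and K: "B + 6 * (real D * Lmax lam D * L) + 2 \<le> K"
  shows "1 - real (Geps lam e) * exp (- (real M / (8 * Lmax lam D * L))) \<le> exp_post lam eta tau C e \<theta> (K * \<Phi>)"
    and "exp_post lam eta tau C e \<theta> (K * \<Phi>) \<le> 1"
proof -
  let ?q = "exp (- (real M / (8 * Lmax lam D * L)))"
  note M1 = mstar_ge_1[OF e_range(1)] and \<Phi> = Phistar_pos[OF e_range(1)]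
  have "0 \<le> 2 * \<delta> / \<kappa>" using \<delta> assmM by simp
  then have D1: "1 \<le> D" using D by linarith
  have Q: "1 \<le> Lmax lam D * L" using mult_mono[OF one_le_Lmax[OF D1] L_ge] one_le_Lmax[OF D1] by simp
  have "real M / (8 * Lmax lam D * L) \<le> real M / 8"
    using Q by (intro divide_left_mono) auto
  also have "\<dots> \<le> C * real M / 8" using mult_right_mono[OF C_ge, of "real M"] by simp
  finally have le: "real M / (8 * Lmax lam D * L) \<le> C * real M / 8" .
  have "0 \<le> C * real M" using C_ge by simp
  \<comment> \<open>The Chernoff rate is the slowest of the three, so one \<open>q\<close> serves
    all dimensions.\<close>
  with le have q: "exp (- (C * real M / 4)) \<le> ?q" "exp (- (C * real M / 2)) \<le> ?q"
    unfolding exp_le_cancel_iff by linarith+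
  have cases: "(\<integral>\<^sup>+\<xi>. ennreal (postM lam eta tau C e (S.obs \<xi>) m) \<partial>noise) \<le> ennreal ?q \<or>
    (\<integral>\<^sup>+\<xi>. ennreal (S.miss m (K * \<Phi>) \<xi>) \<partial>noise) \<le> ennreal ?q" if m: "m \<in> {1..Geps lam e}" for m
  proof (cases "D * M \<le> m")
    case True
    from postM_large_dimension[OF M(1) \<delta> D m True] show ?thesis
      using ennreal_leI[OF q(2)] order_trans by blast
  next
    case small: False
    show ?thesis
    proof (cases "S.tail m \<le> B * \<Phi>")
      case True
      with miss_moderate_dimension[OF m _ D1 True K M(2)] small show ?thesis by simp
    next
      case False
      \<comment> \<open>A bias above \<open>B * \<Phi>\<close> can only occur below the oracle:
        beyond \<open>M\<close> the tail is at most \<open>a M * \<delta>\<close>.\<close>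
      have "m \<le> M"
      proof (rule ccontr)
        assume "\<not> m \<le> M"
        then have "S.tail m \<le> S.tail M"
          using tail_diff[of M m] sum_nonneg[of "{M<..m}" "\<lambda>j. (S.offset j)\<^sup>2"] by simp
        also have "\<dots> \<le> a M * \<delta>"
          using order_trans[OF tail_le_energy[OF M1] mult_left_mono[OF \<delta>(2)]] a_pos[OF M1] by simp
        also have "\<dots> \<le> \<Phi> * B"
        proof (intro mult_mono a_mstar_le_Phistar)
          show "\<delta> \<le> B" using B L_ge C_ge d_pos by (smt (verit) divide_pos_pos mult_nonneg_nonneg)
        qed (use \<Phi> \<delta> in auto)
        finally show False using False by (simp add: mult.commute)
      qed
      from postM_small_dimension[OF M(1) \<delta> B this] False show ?thesis
        using ennreal_leI[OF q(1)] order_trans by fastforce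
    qed
  qed
  show "1 - real (Geps lam e) * ?q \<le> exp_post lam eta tau C e \<theta> (K * \<Phi>)"
    and "exp_post lam eta tau C e \<theta> (K * \<Phi>) \<le> 1"
    using S.exp_post_bounds[OF _ cases] by simp_all
qed

end

section \<open>Passage to the limit\<close>

context hier_model
begin

text \<open>Eventually \<open>ln Geps\<close> is below half of the exponent
  \<open>mstar / c\<close>, and the other half still tends to infinity.\<close>

lemma Geps_exp_mstar_tendsto_0:
  assumes logG: "((\<lambda>e. ln (real (Geps lam e)) / real (mstar a lam e)) \<longlongrightarrow> 0) (at_right 0)"
    and c: "0 < c"
  shows "((\<lambda>e. real (Geps lam e) * exp (- (real (mstar a lam e) / c))) \<longlongrightarrow> 0) (at_right 0)"
proof (rule tendsto_sandwich[where f="\<lambda>_. 0"])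
  have "filterlim (\<lambda>e. real (mstar a lam e) * (1 / (2 * c))) at_top (at_right 0)"
    using c by (intro filterlim_at_top_mult_tendsto_pos[OF tendsto_const])
      (auto intro: filterlim_compose[OF filterlim_real_sequentially mstar_at_top])
  then have "filterlim (\<lambda>e. - (real (mstar a lam e) * (1 / (2 * c)))) at_bot (at_right 0)"
    by (subst (asm) filterlim_uminus_at_top)
  then show "((\<lambda>e. exp (- (real (mstar a lam e) * (1 / (2 * c))))) \<longlongrightarrow> 0) (at_right 0)"
    by (rule filterlim_compose[OF exp_at_bot])
  have "\<forall>\<^sub>F e in at_right 0. ln (real (Geps lam e)) / real (mstar a lam e) < 1 / (2 * c)"
    using c by (intro order_tendstoD(2)[OF logG]) auto
  moreover have "\<forall>\<^sub>F e in at_right (0::real). e \<in> {0<..<1}"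
    by (rule eventually_at_right_real) simp
  ultimately show "\<forall>\<^sub>F e in at_right 0. real (Geps lam e) * exp (- (real (mstar a lam e) / c))
    \<le> exp (- (real (mstar a lam e) * (1 / (2 * c))))"
  proof eventually_elim
    case (elim e)
    then have e: "0 < e" "e < 1" by auto
    have G: "0 < real (Geps lam e)" using one_le_Geps[OF e, of lam] by simp
    have "ln (real (Geps lam e)) \<le> real (mstar a lam e) * (1 / (2 * c))"
      using elim(1) mstar_ge_1[OF e(1)] by (simp add: field_simps)
    then have "ln (real (Geps lam e)) - real (mstar a lam e) / c \<le> - (real (mstar a lam e) * (1 / (2 * c)))"
      using c by (simp add: field_simps)
    then have "exp (ln (real (Geps lam e)) - real (mstar a lam e) / c) \<le> exp (- (real (mstar a lam e) * (1 / (2 * c))))"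
      by simp
    then show ?case using G by (simp add: exp_diff exp_minus field_simps)
  qed
qed auto

text \<open>The threshold on the noise level does not depend on \<theta> or \<open>K\<close>; only
  the energy condition does. The same statement thus serves a fixed parameter and the infimum over
  the ellipsoid.\<close>

lemma eventually_exp_post_concentration:
  assumes D: "3 + 2 * \<delta> / \<kappa> \<le> real D" and \<delta>: "0 \<le> \<delta>"
    and K: "7 * L * C * (1 + 1/d) + \<delta> + 6 * (real D * Lmax lam D * L) + 2 \<le> K0"
  shows "\<forall>\<^sub>F e in at_right 0. \<forall>\<theta>\<in>Theta a eta r. \<forall>K\<ge>K0. energy \<theta> (mstar a lam e) \<le> \<delta> \<longrightarrow>
    exp_post lam eta tau C e \<theta> (K * Phistar a lam e)
      \<in> {1 - real (Geps lam e) * exp (- (real (mstar a lam e) / (8 * Lmax lam D * L)))..1}"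
proof -
  have "filterlim (\<lambda>e. real (mstar a lam e)) at_top (at_right 0)"
    by (rule filterlim_compose[OF filterlim_real_sequentially mstar_at_top])
  then have "\<forall>\<^sub>F e in at_right 0. 4 * r * Lmax lam D * L / d\<^sup>2 \<le> real (mstar a lam e)"
    by (simp add: filterlim_at_top)
  moreover have "\<forall>\<^sub>F e in at_right (0::real). e \<in> {0<..<eo}"
    by (rule eventually_at_right_real) (rule eo)
  ultimately show ?thesis using eventually_mstar_le_Geps
  proof eventually_elim
    case (elim e)
    show ?case
    proof (intro ballI allI impI)
      fix \<theta> K assume \<theta>: "\<theta> \<in> Theta a eta r" and K': "K0 \<le> K" "energy \<theta> (mstar a lam e) \<le> \<delta>"
      interpret hier_model_at lam eta a tau d C L r eo e \<theta>
        using elim \<theta> by unfold_locales auto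
      show "exp_post lam eta tau C e \<theta> (K * \<Phi>)
        \<in> {1 - real (Geps lam e) * exp (- (real M / (8 * Lmax lam D * L)))..1}"
        using exp_post_concentration[OF elim(3,1) \<delta> K'(2) D order_refl, of K] K K' by simp
    qed
  qed
qed

lemma exp_post_tendsto_1:
  assumes logG: "((\<lambda>e. ln (real (Geps lam e)) / real (mstar a lam e)) \<longlongrightarrow> 0) (at_right 0)"
    and D: "5 * L / \<kappa> \<le> real D" and \<theta>: "\<theta> \<in> Theta a eta r"
    and K: "16 * L * max (8 * C * (1 + 1/d)) (real D * Lmax lam D) \<le> K"
  shows "((\<lambda>e. exp_post lam eta tau C e \<theta> (K * Phistar a lam e)) \<longlongrightarrow> 1) (at_right 0)"
proof (rule tendsto_sandwich)
  \<comment> \<open>With \<delta> = 1 the requirement on \<open>D\<close> is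
    \<open>3 + 2 / \<kappa>\<close>, at most \<open>5 / \<kappa>\<close> because \<kappa> \<le> 1.
    For a fixed \<theta> the energy eventually drops below 1.\<close>
  have "5 / \<kappa> \<le> 5 * L / \<kappa>" using L_ge assmM by (intro divide_right_mono) auto
  moreover have "1 \<le> 1 / \<kappa>" using kappastar_le_1 assmM by simp
  ultimately have D': "3 + 2 * 1 / \<kappa> \<le> real D" and "1 \<le> D" using D by auto
  then have Q: "1 \<le> Lmax lam D * L" using mult_mono[OF one_le_Lmax L_ge] one_le_Lmax[of D] by simp
  define y z where "y = L * C * (1 + 1/d)" and "z = real D * Lmax lam D * L"
  have "1 * 1 * 1 \<le> y" unfolding y_def using L_ge C_ge d_pos by (intro mult_mono) auto
  moreover have "16 * L * u \<le> K" if "u \<le> max (8 * C * (1 + 1/d)) (real D * Lmax lam D)" for u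
    using order_trans[OF mult_left_mono[OF that, of "16 * L"] K] L_ge by simp
  from this[OF max.cobounded1] this[OF max.cobounded2] have "128 * y \<le> K" "16 * z \<le> K" by (simp_all add: y_def z_def mult_ac)
  \<comment> \<open>As \<open>y \<ge> 1\<close>, \<open>7*y + 3\<close> is at most
    \<open>10*y\<close> and so at most \<open>10/128 * K\<close>; \<open>6*z\<close> is at most
    \<open>6/16 * K\<close>.\<close>
  ultimately have "7 * y + 1 + 6 * z + 2 \<le> K" by linarith
  then have K': "7 * L * C * (1 + 1/d) + 1 + 6 * (real D * Lmax lam D * L) + 2 \<le> K"
    by (simp add: y_def z_def mult.assoc)
  have "filterlim (\<lambda>e. energy \<theta> (mstar a lam e)) (nhds 0) (at_right 0)"
    by (rule filterlim_compose[OF energy_tendsto_0[OF \<theta>] mstar_at_top])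
  then have "\<forall>\<^sub>F e in at_right 0. energy \<theta> (mstar a lam e) < 1"
    by (rule order_tendstoD) simp
  then have ev: "\<forall>\<^sub>F e in at_right 0. exp_post lam eta tau C e \<theta> (K * Phistar a lam e)
      \<in> {1 - real (Geps lam e) * exp (- (real (mstar a lam e) / (8 * Lmax lam D * L)))..1}"
    using eventually_exp_post_concentration[OF D' zero_le_one K']
  proof eventually_elim
    case (elim e)
    then show ?case using \<theta> by auto
  qed
  show "\<forall>\<^sub>F e in at_right 0. 1 - real (Geps lam e) * exp (- (real (mstar a lam e) / (8 * Lmax lam D * L)))
    \<le> exp_post lam eta tau C e \<theta> (K * Phistar a lam e)"
    and "\<forall>\<^sub>F e in at_right 0. exp_post lam eta tau C e \<theta> (K * Phistar a lam e) \<le> 1"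
    using ev by (auto elim: eventually_mono)
  show "((\<lambda>e. 1 - real (Geps lam e) * exp (- (real (mstar a lam e) / (8 * Lmax lam D * L)))) \<longlongrightarrow> 1) (at_right 0)"
    using tendsto_diff[OF tendsto_const[of 1] Geps_exp_mstar_tendsto_0[OF logG]] Q by (simp add: mult.assoc)
qed simp

text \<open>Uniformly the energy is only known to be at most \<open>r\<close>, so \<delta> =
  \<open>r\<close>. The resulting larger \<open>D\<close> and \<open>K0\<close> do not depend on the
  noise level, hence \<open>K\<close> eventually exceeds \<open>K0\<close>.\<close>

lemma Inf_exp_post_tendsto_1:
  assumes logG: "((\<lambda>e. ln (real (Geps lam e)) / real (mstar a lam e)) \<longlongrightarrow> 0) (at_right 0)"
    and K: "filterlim K at_top (at_right 0)"
  shows "((\<lambda>e. Inf ((\<lambda>\<theta>. exp_post lam eta tau C e \<theta> (K e * Phistar a lam e)) ` Theta a eta r)) \<longlongrightarrow> 1) (at_right 0)"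
proof (rule tendsto_sandwich)
  define D where "D = nat \<lceil>3 + 2 * r / \<kappa>\<rceil>"
  have D: "3 + 2 * r / \<kappa> \<le> real D" unfolding D_def by (rule real_nat_ceiling_ge)
  have "0 \<le> 2 * r / \<kappa>" using r_pos assmM by simp
  then have "1 \<le> D" using D by linarith
  then have Q: "1 \<le> Lmax lam D * L" using mult_mono[OF one_le_Lmax L_ge] one_le_Lmax[of D] by simp
  define K0 where "K0 = 7 * L * C * (1 + 1/d) + r + 6 * (real D * Lmax lam D * L) + 2"
  have "\<forall>\<^sub>F e in at_right 0. K0 \<le> K e" using K by (simp add: filterlim_at_top)
  then have ev: "\<forall>\<^sub>F e in at_right 0. \<forall>\<theta>\<in>Theta a eta r. exp_post lam eta tau C e \<theta> (K e * Phistar a lam e)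
      \<in> {1 - real (Geps lam e) * exp (- (real (mstar a lam e) / (8 * Lmax lam D * L)))..1}"
    using eventually_exp_post_concentration[OF D less_imp_le[OF r_pos] order_refl]
  proof eventually_elim
    case (elim e)
    then show ?case using energy_le unfolding K0_def by blast
  qed
  \<comment> \<open>The infimum is over a nonempty set; \<open>eta\<close> also serves as the
    witness that it is at most 1.\<close>
  have eta: "eta \<in> Theta a eta r" by (simp add: Theta_def)
  show "\<forall>\<^sub>F e in at_right 0. 1 - real (Geps lam e) * exp (- (real (mstar a lam e) / (8 * Lmax lam D * L)))
    \<le> Inf ((\<lambda>\<theta>. exp_post lam eta tau C e \<theta> (K e * Phistar a lam e)) ` Theta a eta r)"
    using ev by eventually_elim (intro cINF_greatest, use eta in auto)
  show "\<forall>\<^sub>F e in at_right 0. Inf ((\<lambda>\<theta>. exp_post lam eta tau C e \<theta> (K e * Phistar a lam e)) ` Theta a eta r) \<le> 1"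
    using ev
  proof eventually_elim
    case (elim e)
    then have "bdd_below ((\<lambda>\<theta>. exp_post lam eta tau C e \<theta> (K e * Phistar a lam e)) ` Theta a eta r)"
      by (intro bdd_belowI2[where m = "1 - real (Geps lam e) * exp (- (real (mstar a lam e) / (8 * Lmax lam D * L)))"]) simp
    then have "Inf ((\<lambda>\<theta>. exp_post lam eta tau C e \<theta> (K e * Phistar a lam e)) ` Theta a eta r)
      \<le> exp_post lam eta tau C e eta (K e * Phistar a lam e)"
      using eta by (rule cINF_lower)
    also have "\<dots> \<le> 1" using elim eta by simp
    finally show ?case .
  qed
  show "((\<lambda>e. 1 - real (Geps lam e) * exp (- (real (mstar a lam e) / (8 * Lmax lam D * L)))) \<longlongrightarrow> 1) (at_right 0)"
    using tendsto_diff[OF tendsto_const[of 1] Geps_exp_mstar_tendsto_0[OF logG]] Q by (simp add: mult.assoc)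
qed simp

end

theorem mainTheorem16:
  fixes lam eta a :: "nat \<Rightarrow> real"
    and tau :: "real \<Rightarrow> nat \<Rightarrow> real"
    and d C L r eo :: real
  assumes lam_bdd: "\<exists>B. \<forall>j. \<bar>lam j\<bar> \<le> B"
    and lam_nz: "\<forall>j\<ge>1. lam j \<noteq> 0"
    and tau_pos: "\<forall>e. 0 < e \<and> e < 1 \<longrightarrow> (\<forall>j\<ge>1. 0 < tau e j)"
    and eo: "0 < eo" "eo < 1"
    (* sequence a *)
    and a_pos: "\<forall>j\<ge>1. 0 < a j"
    and a_mono: "\<forall>j k. 1 \<le> j \<and> j \<le> k \<longrightarrow> a k \<le> a j"
    and a_1: "a 1 = 1"
    and a_lim: "a \<longlonglongrightarrow> 0"
    (* Assumption A *)
    and d_pos: "0 < d"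
    and assmA: "\<forall>e. 0 < e \<and> e < 1 \<longrightarrow> (\<forall>j\<in>{1..Geps lam e}.
                  d * max (sqrt e * sqrt (Lam lam j)) (e * Lam lam j) \<le> tau e j)"
    (* Assumption E *)
    and C_ge: "1 \<le> C" and L_ge: "1 \<le> L"
    and assmE1: "\<forall>k\<ge>1. \<forall>j>k. (lam j)\<^sup>2 \<le> C * Min ((\<lambda>i. (lam i)\<^sup>2) ` {1..k})"
    and assmE2: "\<forall>k\<ge>1. \<forall>l\<ge>1. Lmax lam (k * l) \<le> Lmax lam k * Lmax lam l"
    and assmE3: "\<forall>k\<ge>1. Lmax lam k / Lbar lam k \<le> L"
    (* Assumption M *)
    and assmM: "0 < kappastar a lam eo"
    (* radius and growth condition *)
    and r_pos: "0 < r"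
    and logG: "((\<lambda>e. ln (real (Geps lam e)) / real (mstar a lam e)) \<longlongrightarrow> 0) (at_right 0)"
  shows
    "(let Dst = nat \<lceil>5 * L / kappastar a lam eo\<rceil>;
          Kst = 16 * max (1 + 1 / d) (r / d\<^sup>2) * L\<^sup>2
                   * max (8 * C * (1 + 1 / d)) (real Dst * Lmax lam Dst) * max 1 r
      in \<forall>\<theta>\<in>Theta a eta r.
           ((\<lambda>e. exp_post lam eta tau C e \<theta> (Kst * Phistar a lam e)) \<longlongrightarrow> 1) (at_right 0))
     \<and>
     (\<forall>K :: real \<Rightarrow> real.
        (\<forall>e. 0 < e \<and> e < 1 \<longrightarrow> 0 < K e) \<and>
        (\<forall>e1 e2. 0 < e1 \<and> e1 \<le> e2 \<and> e2 < 1 \<longrightarrow> K e2 \<le> K e1) \<and>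
        filterlim K at_top (at_right 0)
        \<longrightarrow> ((\<lambda>e. Inf ((\<lambda>\<theta>. exp_post lam eta tau C e \<theta> (K e * Phistar a lam e)) ` Theta a eta r))
               \<longlongrightarrow> 1) (at_right 0))"
proof -
  interpret hier_model lam eta a tau d C L r eo
    using assms by unfold_locales auto
  define D where "D = nat \<lceil>5 * L / kappastar a lam eo\<rceil>"
  define K where "K = 16 * max (1 + 1 / d) (r / d\<^sup>2) * L\<^sup>2
    * max (8 * C * (1 + 1 / d)) (real D * Lmax lam D) * max 1 r"
  have D: "5 * L / kappastar a lam eo \<le> real D" unfolding D_def by (rule real_nat_ceiling_ge)
  let ?X = "max (8 * C * (1 + 1 / d)) (real D * Lmax lam D)"
  have X: "0 \<le> ?X" using C_ge d_pos by (simp add: le_max_iff_disj)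
  \<comment> \<open>The stated constant dominates the smaller one that suffices: both outer maxima
    are at least 1, and \<open>L \<ge> 1\<close> gives L \<le> \<open>L\<^sup>2\<close>.\<close>
  have "1 * L * ?X * 1 \<le> max (1 + 1 / d) (r / d\<^sup>2) * L\<^sup>2 * ?X * max 1 r"
    using d_pos L_ge X by (intro mult_mono) (auto simp: le_max_iff_disj power2_eq_square)
  then have K: "16 * L * ?X \<le> K" by (simp add: K_def mult.assoc)
  show ?thesis
    unfolding Let_def D_def[symmetric] K_def[symmetric]
    using exp_post_tendsto_1[OF logG D _ K] Inf_exp_post_tendsto_1[OF logG] by blast
qed

end
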